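(* Let $\Omega\subset\mathbb{R}^N$, $N\ge2$, be a bounded domain of class $C^2$ and let $h:\Omega\times\mathbb{R}\to\mathbb{R}$ satisfy: $(h_1)$ $h$ is a Carathéodory function and for every $\varrho>0$ there exists $\alpha_\varrho\in L^\infty(\Omega)$ such that $|h(x,s)|\le\alpha_\varrho(x)$ for a.e. $x\in\Omega$ and all $|s|\le\varrho$; $(h_2')$ $h(x,s)s>0$ for a.e. $x\in\Omega$ and all $s\ne0$. Let $\lambda\in\mathbb{R}$ be fixed and let $M>0$ be such that, for every $\mu\ge M$, $u_\mu$ is a solution of $$ -\operatorname{div}\left(\frac{\nabla u}{\sqrt{1-|\nabla u|^2}}\right)=\lambda u+\mu h(x,u)\ \text{ in }\Omega,\qquad u=0\ \text{ on }\partial\Omega, $$ satisfying $I_\mu(u_\mu)=\inf_{u\in C(\overline\Omega)}I_\mu(u)$ and $u_\mu\ge0$ in $\Omega$. Then every uniform limit $u_\infty$ of $u_\mu$ along a sequence $\mu\to+\infty$ equals $\operatorname{dist}(\cdot,\partial\Omega)$, and $$ u_\mu\to\operatorname{dist}(\cdot,\partial\Omega)\quad\text{uniformly in }\overline\Omega\text{ as }\mu\to+\infty. $$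
   Context: A solution of the problem is a function $u\in W^{2,q}(\Omega)$ for some $q>N$ such that $\|\nabla u\|_{L^\infty(\Omega)}<1$, $u$ satisfies the equation a.e. in $\Omega$, and $u$ vanishes on $\partial\Omega$. Set $K_0:=\{u\in W^{1,\infty}(\Omega):\|\nabla u\|_{L^\infty(\Omega)}\le1,\ u=0\text{ on }\partial\Omega\}$ and $H(x,s):=\int_0^sh(x,\tau)\,d\tau$. For fixed $\lambda$, the functional $I_\mu:C(\overline\Omega)\to(-\infty,+\infty]$ is $$ I_\mu(u):=\Psi(u)-\frac\lambda2\int_\Omega u^2\,dx-\mu\int_\Omega H(x,u)\,dx, $$ where $\Psi(u):=\int_\Omega\left(1-\sqrt{1-|\nabla u|^2}\right)dx$ if $u\in K_0$ and $\Psi(u):=+\infty$ if $u\in C(\overline\Omega)\setminus K_0$. *)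

theory Defs
  imports "HOL-Analysis.Analysis" "HOL-Probability.Essential_Supremum"
begin

text \<open>The space $\mathbb{R}^N$ is an arbitrary Euclidean space \<open>'a\<close>, with \<open>N = DIM('a)\<close> and
  coordinate directions \<open>Basis\<close>. Functions on $\Omega$ or $\overline\Omega$ are total functions on
  \<open>'a\<close> whose values elsewhere are irrelevant; \<open>lebesgue_on \<Omega>\<close> is Lebesgue measure on $\Omega$.\<close>

section \<open>Smooth functions and domains of class \<open>C\<^sup>2\<close>\<close>

primrec C_diff :: "nat \<Rightarrow> ('a::euclidean_space \<Rightarrow> real) \<Rightarrow> bool" where
  "C_diff 0 f \<longleftrightarrow> continuous_on UNIV f"
| "C_diff (Suc k) f \<longleftrightarrow>
     (\<forall>x. f differentiable (at x)) \<and> (\<forall>i\<in>Basis. C_diff k (\<lambda>x. frechet_derivative f (at x) i))"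

definition test_functions :: "'a::euclidean_space set \<Rightarrow> ('a \<Rightarrow> real) set" where
  "test_functions \<Omega> =
     {\<phi>. (\<forall>k. C_diff k \<phi>) \<and> compact (closure {x. \<phi> x \<noteq> 0}) \<and> closure {x. \<phi> x \<noteq> 0} \<subseteq> \<Omega>}"

text \<open>Near each boundary point, $\Omega$ is the part of a ball lying strictly above the graph of a
  \<open>C\<^sup>2\<close> function \<open>\<gamma>\<close> over the hyperplane orthogonal to a unit vector \<open>e\<close>. A \<open>C\<^sup>2\<close> function on that
  hyperplane is the restriction of one on the whole space, so \<open>\<gamma>\<close> is taken on \<open>'a\<close> and evaluated only
  at the orthogonal projection of \<open>x\<close>.\<close>

definition C2_boundary :: "'a::euclidean_space set \<Rightarrow> bool" where
  "C2_boundary \<Omega> \<longleftrightarrow>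
     (\<forall>x\<^sub>0\<in>frontier \<Omega>. \<exists>r>0. \<exists>e \<gamma>. norm e = 1 \<and> C_diff 2 \<gamma> \<and>
        (\<forall>x\<in>ball x\<^sub>0 r. x \<in> \<Omega> \<longleftrightarrow> x \<bullet> e > \<gamma> (x - (x \<bullet> e) *\<^sub>R e)))"

definition bounded_C2_domain :: "'a::euclidean_space set \<Rightarrow> bool" where
  "bounded_C2_domain \<Omega> \<longleftrightarrow>
     open \<Omega> \<and> connected \<Omega> \<and> \<Omega> \<noteq> {} \<and> bounded \<Omega> \<and> C2_boundary \<Omega>"

section \<open>Lebesgue and Sobolev spaces\<close>

definition Linf_norm :: "'a::euclidean_space set \<Rightarrow> ('a \<Rightarrow> 'b::real_normed_vector) \<Rightarrow> ereal" where
  "Linf_norm \<Omega> f = esssup (lebesgue_on \<Omega>) (\<lambda>x. ereal (norm (f x)))"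

definition L_space :: "ereal \<Rightarrow> 'a::euclidean_space set \<Rightarrow> ('a \<Rightarrow> real) set" where
  "L_space p \<Omega> = {f \<in> borel_measurable (lebesgue_on \<Omega>).
     if p = \<infinity> then Linf_norm \<Omega> f < \<infinity>
     else integrable (lebesgue_on \<Omega>) (\<lambda>x. \<bar>f x\<bar> powr real_of_ereal p)}"

definition locally_integrable :: "'a::euclidean_space set \<Rightarrow> ('a \<Rightarrow> real) \<Rightarrow> bool" where
  "locally_integrable \<Omega> f \<longleftrightarrow>
     (\<forall>K. compact K \<and> K \<subseteq> \<Omega> \<longrightarrow> integrable (lebesgue_on K) f)"

definition has_weak_partial ::
    "'a::euclidean_space set \<Rightarrow> 'a \<Rightarrow> ('a \<Rightarrow> real) \<Rightarrow> ('a \<Rightarrow> real) \<Rightarrow> bool" where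
  "has_weak_partial \<Omega> i u v \<longleftrightarrow> locally_integrable \<Omega> u \<and> locally_integrable \<Omega> v \<and>
     (\<forall>\<phi>\<in>test_functions \<Omega>.
        (LINT x|lebesgue_on \<Omega>. u x * frechet_derivative \<phi> (at x) i) =
        - (LINT x|lebesgue_on \<Omega>. v x * \<phi> x))"

primrec sobolev :: "nat \<Rightarrow> ereal \<Rightarrow> 'a::euclidean_space set \<Rightarrow> ('a \<Rightarrow> real) set" where
  "sobolev 0 p \<Omega> = L_space p \<Omega>"
| "sobolev (Suc k) p \<Omega> =
     {u \<in> L_space p \<Omega>. \<forall>i\<in>Basis. \<exists>v\<in>sobolev k p \<Omega>. has_weak_partial \<Omega> i u v}"

definition has_weak_gradient ::
    "'a::euclidean_space set \<Rightarrow> ('a \<Rightarrow> real) \<Rightarrow> ('a \<Rightarrow> 'a) \<Rightarrow> bool" where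
  "has_weak_gradient \<Omega> u G \<longleftrightarrow> (\<forall>i\<in>Basis. has_weak_partial \<Omega> i u (\<lambda>x. G x \<bullet> i))"

text \<open>The weak gradient is unique only up to a null set. The choice of representative does not
  matter below, where it enters only through integrals, essential suprema, weak derivatives and
  almost-everywhere statements about functions that do have a weak gradient.\<close>

definition weak_gradient :: "'a::euclidean_space set \<Rightarrow> ('a \<Rightarrow> real) \<Rightarrow> 'a \<Rightarrow> 'a" where
  "weak_gradient \<Omega> u = (SOME G. has_weak_gradient \<Omega> u G)"

definition has_weak_divergence ::
    "'a::euclidean_space set \<Rightarrow> ('a \<Rightarrow> 'a) \<Rightarrow> ('a \<Rightarrow> real) \<Rightarrow> bool" where
  "has_weak_divergence \<Omega> F d \<longleftrightarrow>
     (\<exists>D. (\<forall>i\<in>Basis. has_weak_partial \<Omega> i (\<lambda>x. F x \<bullet> i) (D i)) \<and> d = (\<lambda>x. \<Sum>i\<in>Basis. D i x))"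

section \<open>The Dirichlet problem and its functional\<close>

definition caratheodory :: "'a::euclidean_space set \<Rightarrow> ('a \<Rightarrow> real \<Rightarrow> real) \<Rightarrow> bool" where
  "caratheodory \<Omega> h \<longleftrightarrow>
     (\<forall>s. (\<lambda>x. h x s) \<in> borel_measurable (lebesgue_on \<Omega>)) \<and>
     (AE x in lebesgue_on \<Omega>. continuous_on UNIV (h x))"

definition C_closure :: "'a::euclidean_space set \<Rightarrow> ('a \<Rightarrow> real) set" where
  "C_closure \<Omega> = {u. continuous_on (closure \<Omega>) u}"

text \<open>Elements of \<open>W\<^sup>2\<^sup>,\<^sup>q\<close> with \<open>q > N\<close> and of \<open>W\<^sup>1\<^sup>,\<^sup>\<infinity>\<close> on a bounded \<open>C\<^sup>2\<close> domain are identified, as usual,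
  with their representative that is continuous up to the boundary; this is the role of
  \<open>C_closure\<close> in the next two definitions, and boundary values are pointwise values.\<close>

definition is_solution ::
    "'a::euclidean_space set \<Rightarrow> ('a \<Rightarrow> real \<Rightarrow> real) \<Rightarrow> real \<Rightarrow> real \<Rightarrow> ('a \<Rightarrow> real) \<Rightarrow> bool" where
  "is_solution \<Omega> h lam \<mu> u \<longleftrightarrow>
     u \<in> C_closure \<Omega> \<and>
     (\<exists>q::real. q > real DIM('a) \<and> u \<in> sobolev 2 (ereal q) \<Omega>) \<and>
     Linf_norm \<Omega> (weak_gradient \<Omega> u) < 1 \<and>
     (\<exists>d. has_weak_divergence \<Omega>
            (\<lambda>x. weak_gradient \<Omega> u x /\<^sub>R sqrt (1 - (norm (weak_gradient \<Omega> u x))\<^sup>2)) d \<and>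
          (AE x in lebesgue_on \<Omega>. - d x = lam * u x + \<mu> * h x (u x))) \<and>
     (\<forall>x\<in>frontier \<Omega>. u x = 0)"

definition K_zero :: "'a::euclidean_space set \<Rightarrow> ('a \<Rightarrow> real) set" where
  "K_zero \<Omega> = {u \<in> C_closure \<Omega>. u \<in> sobolev 1 \<infinity> \<Omega> \<and>
     Linf_norm \<Omega> (weak_gradient \<Omega> u) \<le> 1 \<and> (\<forall>x\<in>frontier \<Omega>. u x = 0)}"

definition H_prim :: "('a \<Rightarrow> real \<Rightarrow> real) \<Rightarrow> 'a \<Rightarrow> real \<Rightarrow> real" where
  "H_prim h x s = (LBINT \<tau>=0..s. h x \<tau>)"

definition Psi :: "'a::euclidean_space set \<Rightarrow> ('a \<Rightarrow> real) \<Rightarrow> ereal" where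
  "Psi \<Omega> u =
     (if u \<in> K_zero \<Omega>
      then ereal (LINT x|lebesgue_on \<Omega>. 1 - sqrt (1 - (norm (weak_gradient \<Omega> u x))\<^sup>2))
      else \<infinity>)"

definition I_fun ::
    "'a::euclidean_space set \<Rightarrow> ('a \<Rightarrow> real \<Rightarrow> real) \<Rightarrow> real \<Rightarrow> real \<Rightarrow> ('a \<Rightarrow> real) \<Rightarrow> ereal" where
  "I_fun \<Omega> h lam \<mu> u =
     Psi \<Omega> u - ereal (lam / 2 * (LINT x|lebesgue_on \<Omega>. (u x)\<^sup>2))
       - ereal (\<mu> * (LINT x|lebesgue_on \<Omega>. H_prim h x (u x)))"

end

theory Submission
  imports Defs
begin

text \<open>Write \<open>d\<close> for the distance to the boundary. Two facts squeeze the minimizers towards \<open>d\<close>.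

From above, every admissible \<open>u\<close> satisfies \<open>\<bar>u\<bar> \<le> d\<close>: a continuous function whose weak gradient is at most
one is 1-Lipschitz on balls inside \<open>\<Omega>\<close> (\<open>weak_gradient_imp_lipschitz\<close>, by mollification), and it can be
followed from a point to the nearest boundary point, where it vanishes (\<open>K_zero_le_distance\<close>).

From below, only the potential term of the functional carries the large factor \<open>\<mu>\<close>, while the other
terms are bounded uniformly on the admissible set. Comparing with admissible functions that
approximate \<open>d\<close> (\<open>distance_approximation\<close>) shows that the potentials of \<open>d\<close> and \<open>u\<^sub>\<mu>\<close> differ by at most
\<open>C / \<mu>\<close> (\<open>minimizer_potential_gap\<close>). As the primitive \<open>H\<close> is strictly increasing on positive numbers, \<open>d\<close> is
the unique maximizer of the potential among nonnegative admissible functions, and quantitatively so: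
a nonnegative admissible function that falls short of \<open>d\<close> by \<open>2 \<delta>\<close> at one point does so by \<open>\<delta>\<close> on a
ball of fixed radius, since it is 1-Lipschitz, and thereby loses at least an amount \<open>m > 0\<close> of
potential that is independent of the function (\<open>potential_gap_if_below_distance\<close>). Hence for \<open>\<mu> > C / m\<close> the
minimizer is everywhere within \<open>2 \<delta>\<close> of \<open>d\<close>, which is the uniform convergence. The statement about
limits along sequences is then uniqueness of limits.

The comparison functions are mollifications, so that their gradients are classical. Admissibility is defined
through a chosen weak gradient; it follows from the classical one because weak gradients are unique
almost everywhere (\<open>weak_gradient_unique\<close>, by the fundamental lemma of the calculus of variations).\<close>

section \<open>Smooth functions with compact support\<close>

text \<open>These are the functions \<open>exp (-1/t) / t^n\<close>, extended by zero to \<open>t \<le> 0\<close>. The whole family is needed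
because differentiating one member gives a combination of the next two.\<close>
definition flat :: "nat \<Rightarrow> real \<Rightarrow> real" where
  "flat n t = (if 0 < t then exp (- inverse t) * inverse t ^ n else 0)"

lemma flat_tendsto_0: "(flat n \<longlongrightarrow> 0) (at 0)"
proof -
  have "((\<lambda>t::real. inverse t ^ n / exp (inverse t)) \<longlongrightarrow> 0) (at_right 0)"
    by (rule filterlim_compose[OF tendsto_power_div_exp_0 filterlim_inverse_at_top_right])
  moreover have "eventually (\<lambda>t. inverse t ^ n / exp (inverse t) = flat n t) (at_right 0)"
    by (auto simp: eventually_at_right_field flat_def exp_minus field_simps intro!: exI[of _ 1])
  ultimately have R: "(flat n \<longlongrightarrow> 0) (at_right 0)"
    using Lim_transform_eventually by blast
  have "eventually (\<lambda>t. 0 = flat n t) (at_left 0)"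
    by (auto simp: eventually_at_left_field flat_def intro!: exI[of _ "-1"])
  then have "(flat n \<longlongrightarrow> 0) (at_left 0)"
    using Lim_transform_eventually[OF tendsto_const] by blast
  with R show ?thesis by (simp add: filterlim_at_split)
qed

text \<open>Only \<open>t = 0\<close> is delicate: the difference quotient of \<open>flat n\<close> there is \<open>flat (n + 1)\<close>, which tends
to zero from both sides.\<close>
lemma flat_has_derivative:
  "(flat n has_real_derivative (flat (n + 2) t - real n * flat (n + 1) t)) (at t)"
proof -
  consider "t < 0" | "t = 0" | "t > 0" by linarith
  then show ?thesis
  proof cases
    case 1
    have "((\<lambda>t. 0) has_real_derivative 0) (at t)" by simp
    then have "(flat n has_real_derivative 0) (at t)"
      by (rule has_field_derivative_transform_within_open[where S="{..<0}"]) (use 1 in \<open>auto simp: flat_def\<close>)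
    then show ?thesis using 1 by (simp add: flat_def)
  next
    case 2
    have "(\<lambda>h. (flat n (0 + h) - flat n 0) / h) = flat (n + 1)"
      by (auto simp: flat_def fun_eq_iff field_simps)
    then show ?thesis
      using flat_tendsto_0[of "n + 1"] 2 by (simp add: DERIV_def) (simp add: flat_def)
  next
    case 3
    have "((\<lambda>t. inverse t ^ n) has_real_derivative - (real n * inverse t ^ (n + 1))) (at t)"
      using DERIV_power[OF DERIV_inverse[of t], of n] 3 by (cases n) (auto simp: algebra_simps)
    moreover have "((\<lambda>t. exp (- inverse t)) has_real_derivative exp (- inverse t) * inverse t ^ 2) (at t)"
      using 3 by (auto intro!: derivative_eq_intros simp: power2_eq_square)
    ultimately have "((\<lambda>t. exp (- inverse t) * inverse t ^ n) has_real_derivative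
       (exp (- inverse t) * inverse t ^ (n + 2) - real n * (exp (- inverse t) * inverse t ^ (n+1)))) (at t)"
      using DERIV_mult by (fastforce simp: algebra_simps power2_eq_square)
    then have "(flat n has_real_derivative
       (exp (- inverse t) * inverse t ^ (n + 2) - real n * (exp (- inverse t) * inverse t ^ (n+1)))) (at t)"
      by (rule has_field_derivative_transform_within_open[where S="{0<..}"]) (use 3 in \<open>auto simp: flat_def\<close>)
    then show ?thesis using 3 by (simp add: flat_def)
  qed
qed

text \<open>Rather than differentiating a bump repeatedly by hand, one works in the smallest algebra that
contains the coordinates and is closed under composition with all \<open>flat n\<close>. It is closed under
partial derivatives, so all its members are smooth.\<close>
inductive flat_algebra :: "('a::euclidean_space \<Rightarrow> real) \<Rightarrow> bool" where
  const: "flat_algebra (\<lambda>x. c)"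
| coord: "flat_algebra (\<lambda>x. x \<bullet> e)"
| add: "flat_algebra f \<Longrightarrow> flat_algebra g \<Longrightarrow> flat_algebra (\<lambda>x. f x + g x)"
| mult: "flat_algebra f \<Longrightarrow> flat_algebra g \<Longrightarrow> flat_algebra (\<lambda>x. f x * g x)"
| flat: "flat_algebra f \<Longrightarrow> flat_algebra (\<lambda>x. flat n (f x))"

lemma flat_algebra_diff:
  assumes "flat_algebra f" "flat_algebra g" shows "flat_algebra (\<lambda>x. f x - g x)"
  using flat_algebra.add[OF assms(1) flat_algebra.mult[OF flat_algebra.const[of "-1"] assms(2)]]
  by simp

lemma flat_algebra_sum:
  "finite S \<Longrightarrow> (\<And>i. i \<in> S \<Longrightarrow> flat_algebra (f i)) \<Longrightarrow> flat_algebra (\<lambda>x. \<Sum>i\<in>S. f i x)"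
  by (induction S rule: finite_induct) (auto intro: flat_algebra.intros)

lemma flat_algebra_prod:
  "finite S \<Longrightarrow> (\<And>i. i \<in> S \<Longrightarrow> flat_algebra (f i)) \<Longrightarrow> flat_algebra (\<lambda>x. \<Prod>i\<in>S. f i x)"
  by (induction S rule: finite_induct) (auto intro: flat_algebra.intros)

lemma flat_algebra_reflect: "flat_algebra f \<Longrightarrow> flat_algebra (\<lambda>y. f (c - y))"
proof (induction rule: flat_algebra.induct)
  case (coord e)
  show ?case unfolding inner_diff_left
    by (intro flat_algebra_diff flat_algebra.const flat_algebra.coord)
qed (auto intro: flat_algebra.intros)

lemma flat_algebra_has_derivative:
  assumes "flat_algebra f"
  shows "\<exists>D. (\<forall>x. (f has_derivative D x) (at x)) \<and> (\<forall>e. flat_algebra (\<lambda>x. D x e))"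
  using assms
proof (induction rule: flat_algebra.induct)
  case (const c)
  show ?case
    by (rule exI[of _ "\<lambda>x e. 0"]) (auto intro: flat_algebra.const)
next
  case (coord e)
  show ?case
    by (rule exI[of _ "\<lambda>x y. y \<bullet> e"])
       (auto intro!: flat_algebra.const bounded_linear_imp_has_derivative bounded_linear_inner_left)
next
  case (add f g)
  then obtain D D' where D: "\<And>x. (f has_derivative D x) (at x)" "\<And>e. flat_algebra (\<lambda>x. D x e)"
    "\<And>x. (g has_derivative D' x) (at x)" "\<And>e. flat_algebra (\<lambda>x. D' x e)" by blast
  show ?case
    by (rule exI[of _ "\<lambda>x e. D x e + D' x e"])
      (auto intro!: flat_algebra.intros D derivative_eq_intros simp: fun_eq_iff)
next
  case (mult f g)
  then obtain D D' where D: "\<And>x. (f has_derivative D x) (at x)" "\<And>e. flat_algebra (\<lambda>x. D x e)"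
    "\<And>x. (g has_derivative D' x) (at x)" "\<And>e. flat_algebra (\<lambda>x. D' x e)" by blast
  show ?case
    by (rule exI[of _ "\<lambda>x e. f x * D' x e + D x e * g x"])
      (auto intro!: flat_algebra.intros D has_derivative_mult mult.hyps)
next
  case (flat f n)
  then obtain D where D: "\<And>x. (f has_derivative D x) (at x)" "\<And>e. flat_algebra (\<lambda>x. D x e)"
    by blast
  have "((\<lambda>x. flat n (f x)) has_derivative
      (\<lambda>e. (flat (n + 2) (f x) - real n * flat (n + 1) (f x)) * D x e)) (at x)" for x
    using has_derivative_compose[OF D(1)[of x]
        flat_has_derivative[of n "f x", unfolded has_field_derivative_def]] by simp
  then show ?case
    by (intro exI[of _ "\<lambda>x e. (flat (n + 2) (f x) - real n * flat (n + 1) (f x)) * D x e"] conjI allI)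
      (auto intro!: flat_algebra.intros D flat_algebra_diff flat.hyps)
qed

lemma flat_algebra_derivative:
  assumes "flat_algebra f"
  shows "(f has_derivative frechet_derivative f (at x)) (at x)"
    and "flat_algebra (\<lambda>x. frechet_derivative f (at x) e)"
proof -
  obtain D where D: "\<And>x. (f has_derivative D x) (at x)" "\<And>e. flat_algebra (\<lambda>x. D x e)"
    using flat_algebra_has_derivative[OF assms] by blast
  have "frechet_derivative f (at x) = D x" for x
    using frechet_derivative_at[OF D(1)] by simp
  then show "(f has_derivative frechet_derivative f (at x)) (at x)"
    "flat_algebra (\<lambda>x. frechet_derivative f (at x) e)" using D by auto
qed

lemma flat_algebra_continuous: "flat_algebra f \<Longrightarrow> continuous_on S f"
  by (meson continuous_at_imp_continuous_on flat_algebra_derivative(1) has_derivative_continuous)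

text \<open>The directional derivatives of a member are members again, so the recursion in \<open>C_diff\<close> never
leaves the algebra.\<close>
lemma flat_algebra_C_diff: "flat_algebra f \<Longrightarrow> C_diff k f"
proof (induction k arbitrary: f)
  case 0
  then show ?case by (simp add: flat_algebra_continuous)
next
  case (Suc k)
  then show ?case using flat_algebra_derivative[OF Suc.prems]
    by (auto simp: differentiable_def)
qed

lemma flat_algebra_test_function:
  assumes "flat_algebra \<phi>" "compact K" "K \<subseteq> \<Omega>" "\<And>x. x \<notin> K \<Longrightarrow> \<phi> x = 0"
  shows "\<phi> \<in> test_functions \<Omega>"
proof -
  have "closure {x. \<phi> x \<noteq> 0} \<subseteq> K"
    using assms by (intro closure_minimal compact_imp_closed) auto
  moreover from this have "compact (closure {x. \<phi> x \<noteq> 0})"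
    using assms(2) by (meson bounded_subset closed_closure compact_eq_bounded_closed)
  ultimately show ?thesis using assms flat_algebra_C_diff unfolding test_functions_def by blast
qed

definition bump :: "real \<Rightarrow> 'a::euclidean_space \<Rightarrow> real" where
  "bump r z = flat 0 (r\<^sup>2 - z \<bullet> z)"

lemma bump_nonneg: "bump r z \<ge> 0"
  by (simp add: bump_def flat_def)

lemma bump_pos_iff: "r > 0 \<Longrightarrow> bump r z > 0 \<longleftrightarrow> norm z < r"
  using abs_square_less_1
  by (auto simp: bump_def flat_def dot_square_norm power_strict_mono) (smt (verit) norm_ge_zero power_mono)

lemma flat_algebra_bump: "flat_algebra (bump r)"
proof -
  have "flat_algebra (\<lambda>z::'a. z \<bullet> z)"
    unfolding euclidean_inner[of z z for z :: 'a]
    by (intro flat_algebra_sum flat_algebra.intros) auto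
  then show ?thesis
    unfolding bump_def by (intro flat_algebra.flat flat_algebra_diff flat_algebra.const)
qed

text \<open>A mollifier is taken from \<open>flat_algebra\<close>, so that its reflected translates are test functions.\<close>
definition mollifier :: "real \<Rightarrow> ('a::euclidean_space \<Rightarrow> real) \<Rightarrow> bool" where
  "mollifier \<epsilon> \<rho> \<longleftrightarrow> flat_algebra \<rho> \<and> (\<forall>z. 0 \<le> \<rho> z) \<and> (\<forall>z. \<epsilon> \<le> norm z \<longrightarrow> \<rho> z = 0) \<and>
     integrable lborel \<rho> \<and> integral\<^sup>L lborel \<rho> = 1"

lemma mollifier_exists:
  assumes "\<epsilon> > 0"
  obtains \<rho> :: "'a::euclidean_space \<Rightarrow> real" where "mollifier \<epsilon> \<rho>"
proof -
  let ?b = "bump \<epsilon> :: 'a \<Rightarrow> real"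
  have zero: "?b z = 0" if "norm z \<ge> \<epsilon>" for z
    using bump_pos_iff[OF assms, of z] bump_nonneg[of \<epsilon> z] that by linarith
  have cont: "continuous_on UNIV ?b" by (rule flat_algebra_continuous[OF flat_algebra_bump])
  have "integrable lborel (\<lambda>z. indicator (cball 0 \<epsilon>) z *\<^sub>R ?b z)"
    using borel_integrable_compact[OF compact_cball continuous_on_subset[OF cont]] by simp
  moreover have "(\<lambda>z. indicator (cball 0 \<epsilon>) z *\<^sub>R ?b z) = ?b"
    using zero by (auto simp: indicator_def fun_eq_iff)
  ultimately have int: "integrable lborel ?b" by simp
  have "integral\<^sup>L lborel ?b > 0"
  proof -
    have "integral\<^sup>L lborel ?b \<noteq> 0"
    proof
      assume "integral\<^sup>L lborel ?b = 0"
      then have "AE x in lborel. ?b x = 0"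
        using integral_nonneg_eq_0_iff_AE[OF int] bump_nonneg by auto
      then have "AE x in lebesgue. x \<in> {x. ?b x = 0}"
        by (simp add: AE_completion)
      \<comment> \<open>A closed set of full measure is everything, but the bump is positive at the origin.\<close>
      moreover have "closed {x. ?b x = 0}"
        by (rule closed_Collect_eq[OF cont continuous_on_const])
      ultimately have "0 \<in> {x. ?b x = 0}"
        by (rule mem_closed_if_AE_lebesgue[rotated])
      then show False using bump_pos_iff[OF assms, of "0::'a"] assms by simp
    qed
    moreover have "integral\<^sup>L lborel ?b \<ge> 0" by (simp add: bump_nonneg)
    ultimately show ?thesis by linarith
  qed
  then show ?thesis
    using int zero bump_nonneg[of \<epsilon>] 
    by (intro that[of "\<lambda>z. inverse (integral\<^sup>L lborel ?b) * ?b z"])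
       (auto simp: mollifier_def
         intro!: flat_algebra.mult flat_algebra.const flat_algebra_bump mult_nonneg_nonneg)
qed

section \<open>Mollification\<close>
lemma bounded_support_integral:
  fixes g :: "'a::euclidean_space \<Rightarrow> real"
  assumes "continuous_on UNIV g" "\<And>x. x \<notin> cbox a b \<Longrightarrow> g x = 0"
  shows "integrable lborel g" and "integral\<^sup>L lborel g = integral (cbox a b) g"
proof -
  have eq: "(\<lambda>z. indicator (cbox a b) z *\<^sub>R g z) = g"
    using assms(2) by (auto simp: indicator_def fun_eq_iff)
  have "integrable lborel (\<lambda>z. indicator (cbox a b) z *\<^sub>R g z)"
    using borel_integrable_compact[OF compact_cbox continuous_on_subset[OF assms(1)]] by simp
  then show "integrable lborel g" by (simp only: eq)
  have "set_integrable lborel (cbox a b) g"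
    using \<open>integrable lborel (\<lambda>z. indicator (cbox a b) z *\<^sub>R g z)\<close> by (simp add: set_integrable_def)
  from set_borel_integral_eq_integral(2)[OF this]
  show "integral\<^sup>L lborel g = integral (cbox a b) g"
    unfolding set_lebesgue_integral_def eq .
qed

lemma bounded_support_integrable:
  fixes g :: "'a::euclidean_space \<Rightarrow> real"
  assumes "continuous_on UNIV g" "bounded S" "\<And>x. x \<notin> S \<Longrightarrow> g x = 0"
  shows "integrable lborel g"
proof -
  obtain a b where "S \<subseteq> cbox a b"
    using bounded_subset_cbox_symmetric[OF assms(2)] by metis
  then show ?thesis using bounded_support_integral(1)[OF assms(1), of a b] assms(3) by blast
qed

lemma lborel_integral_reflect:
  fixes g :: "'a::euclidean_space \<Rightarrow> real"
  assumes [measurable]: "g \<in> borel_measurable borel"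
  shows "integral\<^sup>L lborel (\<lambda>y. g (x - y)) = integral\<^sup>L lborel g"
proof -
  have "integral\<^sup>L lborel g = integral\<^sup>L (density (distr lborel borel (\<lambda>y. x + (-1) *\<^sub>R y)) (\<lambda>_. ennreal (\<bar>-1::real\<bar>^DIM('a)))) g"
    by (subst lborel_affine[of "-1" x]) auto
  also have "\<dots> = integral\<^sup>L lborel (\<lambda>y. g (x - y))"
    by (simp add: density_1 integral_distr)
  finally show ?thesis by simp
qed

lemma lborel_integral_translate:
  fixes g :: "'a::euclidean_space \<Rightarrow> real"
  assumes [measurable]: "g \<in> borel_measurable borel"
  shows "integral\<^sup>L lborel (\<lambda>y. g (y + x)) = integral\<^sup>L lborel g"
proof -
  have "integral\<^sup>L lborel g = integral\<^sup>L (distr lborel borel ((+) x)) g"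
    by (simp add: lborel_distr_plus)
  also have "\<dots> = integral\<^sup>L lborel (\<lambda>y. g (y + x))"
    by (simp add: integral_distr add.commute)
  finally show ?thesis by simp
qed

text \<open>By translation invariance every difference quotient of \<open>\<psi>\<close> in the direction \<open>e\<close> has integral zero. The
mean value theorem bounds the quotients by \<open>B\<close>, and for step sizes at most one they live on a fixed
ball, so dominated convergence carries the identity over to the derivative.\<close>
lemma integral_directional_derivative_eq_0:
  fixes \<psi> :: "'a::euclidean_space \<Rightarrow> real"
  assumes cont: "continuous_on UNIV \<psi>" and S: "bounded S" "\<And>x. x \<notin> S \<Longrightarrow> \<psi> x = 0"
    and der: "\<And>x t. ((\<lambda>t. \<psi> (x + t *\<^sub>R e)) has_real_derivative \<psi>' (x + t *\<^sub>R e)) (at t)"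
    and bound: "\<And>x. \<bar>\<psi>' x\<bar> \<le> B"
  shows "integrable lborel \<psi>'" and "integral\<^sup>L lborel \<psi>' = 0"
proof -
  \<comment> \<open>Step sizes at most one keep the supports of all quotients in one ball.\<close>
  define \<tau> :: "nat \<Rightarrow> real" where "\<tau> n = inverse (real (Suc n))" for n
  have \<tau>: "\<tau> n > 0" "\<tau> n \<le> 1" for n by (auto simp: \<tau>_def field_simps)
  define q where "q n x = (\<psi> (x + \<tau> n *\<^sub>R e) - \<psi> x) / \<tau> n" for n x
  obtain R where R: "\<And>x. x \<in> S \<Longrightarrow> norm x \<le> R" using S(1) bounded_iff by blast
  have psi0: "\<psi> x = 0" if "norm x > R" for x using S(2) R that by force
  have [measurable]: "\<psi> \<in> borel_measurable borel"
    using cont by (simp add: borel_measurable_continuous_onI)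
  have qm[measurable]: "q n \<in> borel_measurable borel" for n unfolding q_def by measurable
  have lim: "(\<lambda>n. q n x) \<longlonglongrightarrow> \<psi>' x" for x
  proof -
    have "((\<lambda>t. (\<psi> (x + t *\<^sub>R e) - \<psi> x) / t) \<longlongrightarrow> \<psi>' x) (at 0)"
      using der[of x 0] by (simp add: DERIV_def)
    moreover have "filterlim \<tau> (at 0) sequentially"
      using LIMSEQ_inverse_real_of_nat \<tau>(1) unfolding filterlim_at \<tau>_def
      by (auto intro!: always_eventually simp: order_less_imp_not_eq2)
    ultimately show ?thesis unfolding q_def by (rule filterlim_compose)
  qed
  have [measurable]: "\<psi>' \<in> borel_measurable lborel"
    by (rule borel_measurable_LIMSEQ_real[of _ q]) (use lim in auto)
  have qb: "\<bar>q n x\<bar> \<le> B" for n x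
  proof -
    obtain z where "0 < z" "z < \<tau> n"
       "\<psi> (x + \<tau> n *\<^sub>R e) - \<psi> (x + 0 *\<^sub>R e) = (\<tau> n - 0) * \<psi>' (x + z *\<^sub>R e)"
      using MVT2[OF \<tau>(1)[of n], of "\<lambda>t. \<psi> (x + t *\<^sub>R e)" "\<lambda>t. \<psi>' (x + t *\<^sub>R e)"] der by auto
    then have "q n x = \<psi>' (x + z *\<^sub>R e)" using \<tau>(1)[of n] by (simp add: q_def)
    then show ?thesis using bound by simp
  qed
  let ?C = "cball 0 (R + norm e) :: 'a set"
  have q0: "q n x = 0" if "x \<notin> ?C" for n x
  proof -
    have *: "norm x > R + norm e" using that by simp
    have "norm x \<le> norm (x + \<tau> n *\<^sub>R e) + norm (\<tau> n *\<^sub>R e)" 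
      using norm_triangle_ineq4[of "x + \<tau> n *\<^sub>R e" "\<tau> n *\<^sub>R e"] by simp
    moreover have "norm (\<tau> n *\<^sub>R e) \<le> norm e" using \<tau>[of n] by (simp add: mult_left_le_one_le)
    ultimately have "norm (x + \<tau> n *\<^sub>R e) > R" using * by linarith
    moreover have "norm x > R" using * norm_ge_zero[of e] by linarith
    ultimately show ?thesis by (simp add: q_def psi0)
  qed
  have w: "integrable lborel (\<lambda>x. indicator ?C x * B)"
    by (intro integrable_mult_left integrable_real_indicator) (use emeasure_bounded_finite[OF bounded_cball] in \<open>auto simp: infinity_ennreal_def\<close>)
  have le: "AE x in lborel. norm (q n x) \<le> indicator ?C x * B" for n
  proof (intro always_eventually allI)
    fix x show "norm (q n x) \<le> indicator ?C x * B"
      using qb[of n x] q0[of x n] by (cases "x \<in> ?C") (auto simp: indicator_def)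
  qed
  have L: "AE x in lborel. (\<lambda>n. q n x) \<longlonglongrightarrow> \<psi>' x" using lim by simp
  have qm': "q n \<in> borel_measurable lborel" for n by simp
  note dct = integrable_dominated_convergence[OF _ qm' w L le]
     integral_dominated_convergence[OF _ qm' w L le]
  show "integrable lborel \<psi>'" by (rule dct(1)) simp
  have int: "integrable lborel \<psi>" by (rule bounded_support_integrable[OF cont S])
  have "integral\<^sup>L lborel (q n) = 0" for n
  proof -
    have "integrable lborel (\<lambda>x. \<psi> (x + \<tau> n *\<^sub>R e))"
    proof (rule bounded_support_integrable[of _ "?C"])
      show "continuous_on UNIV (\<lambda>x. \<psi> (x + \<tau> n *\<^sub>R e))"
        by (intro continuous_on_compose2[OF cont] continuous_intros) auto
      show "\<psi> (x + \<tau> n *\<^sub>R e) = 0" if "x \<notin> ?C" for x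
      proof -
        have "norm x > R + norm e" using that by simp
        then have "norm x > R" using norm_ge_zero[of e] by linarith
        then show ?thesis using q0[OF that, of n] psi0[of x] \<tau>(1)[of n] by (simp add: q_def)
      qed
    qed simp
    then show ?thesis unfolding q_def
      using int lborel_integral_translate[of \<psi> "\<tau> n *\<^sub>R e"] by simp
  qed
  moreover have "(\<lambda>n. integral\<^sup>L lborel (q n)) \<longlonglongrightarrow> integral\<^sup>L lborel \<psi>'" by (rule dct(2)) simp
  ultimately show "integral\<^sup>L lborel \<psi>' = 0" by (simp add: LIMSEQ_const_iff)
qed

definition mollify :: "('a::euclidean_space \<Rightarrow> real) \<Rightarrow> ('a \<Rightarrow> real) \<Rightarrow> 'a \<Rightarrow> real" where
  "mollify \<rho> f x = (\<integral>y. f y * \<rho> (x - y) \<partial>lborel)"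

text \<open>Differentiation under the integral sign; the derivative is again a mollification, now with the
differentiated kernel, so it inherits linearity in \<open>e\<close> from the derivative of \<open>\<rho>\<close>.\<close>
lemma mollify_has_derivative:
  fixes f :: "'a::euclidean_space \<Rightarrow> real"
  assumes cont: "continuous_on UNIV f" and S: "bounded S" "\<And>x. x \<notin> S \<Longrightarrow> f x = 0"
    and \<rho>: "flat_algebra \<rho>"
  shows "((\<lambda>t. mollify \<rho> f (x + t *\<^sub>R e)) has_real_derivative
          mollify (\<lambda>z. frechet_derivative \<rho> (at z) e) f (x + t *\<^sub>R e)) (at t)"
proof -
  obtain a b where ab: "S \<subseteq> cbox a b"
    using bounded_subset_cbox_symmetric[OF S(1)] by metis
  have eq: "mollify k f x = integral (cbox a b) (\<lambda>y. f y * k (x - y))"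
    if "continuous_on UNIV k" for k x
    unfolding mollify_def
    by (rule bounded_support_integral(2))
       (use S(2) ab in \<open>auto intro!: continuous_intros cont continuous_on_compose2[OF that]\<close>)
  let ?D = "\<lambda>z. frechet_derivative \<rho> (at z) e"
  have cr: "continuous_on UNIV \<rho>" "continuous_on UNIV ?D"
    using \<rho> flat_algebra_continuous flat_algebra_derivative(2) by auto
  have "((\<lambda>t. integral (cbox a b) (\<lambda>y. f y * \<rho> (x + t *\<^sub>R e - y))) has_real_derivative
      integral (cbox a b) (\<lambda>y. f y * ?D (x + t *\<^sub>R e - y))) (at t within UNIV)"
  proof (rule leibniz_rule_field_derivative)
    fix t y
    have "((\<lambda>t. x + t *\<^sub>R e - y) has_derivative (\<lambda>t. t *\<^sub>R e)) (at t)"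
      by (auto intro!: derivative_eq_intros)
    from has_derivative_compose[OF this flat_algebra_derivative(1)[OF \<rho>]]
    have "((\<lambda>t. \<rho> (x + t *\<^sub>R e - y)) has_derivative (\<lambda>s. frechet_derivative \<rho> (at (x + t *\<^sub>R e - y)) (s *\<^sub>R e))) (at t)" .
    moreover have "frechet_derivative \<rho> (at (x + t *\<^sub>R e - y)) (s *\<^sub>R e) = ?D (x + t *\<^sub>R e - y) * s" for s
      using linear_cmul[OF has_derivative_linear[OF flat_algebra_derivative(1)[OF \<rho>]]] by simp
    ultimately have "((\<lambda>t. \<rho> (x + t *\<^sub>R e - y)) has_real_derivative ?D (x + t *\<^sub>R e - y)) (at t)"
      by (simp add: has_field_derivative_def)
    then show "((\<lambda>t. f y * \<rho> (x + t *\<^sub>R e - y)) has_real_derivative f y * ?D (x + t *\<^sub>R e - y)) (at t within UNIV)"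
      by (auto intro!: derivative_eq_intros)
  next
    fix t
    show "(\<lambda>y. f y * \<rho> (x + t *\<^sub>R e - y)) integrable_on cbox a b"
      by (intro integrable_continuous continuous_intros continuous_on_compose2[OF cr(1)]
           continuous_on_subset[OF cont]) auto
  next
    show "continuous_on (UNIV \<times> cbox a b) (\<lambda>(t, y). f y * ?D (x + t *\<^sub>R e - y))"
      unfolding split_beta
      by (intro continuous_intros continuous_on_compose2[OF cr(2)] continuous_on_compose2[OF cont]) auto
  qed auto
  then show ?thesis by (simp add: eq[OF cr(1)] eq[OF cr(2)])
qed

lemma mollify_commute:
  fixes f :: "'a::euclidean_space \<Rightarrow> real"
  assumes "continuous_on UNIV f" "continuous_on UNIV \<rho>"
  shows "mollify \<rho> f x = (\<integral>y. f (x - y) * \<rho> y \<partial>lborel)"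
proof -
  have "(\<lambda>y. f (x - y) * \<rho> y) \<in> borel_measurable borel"
    by (intro borel_measurable_continuous_onI continuous_intros continuous_on_compose2[OF assms(1)] assms(2)) auto
  from lborel_integral_reflect[OF this, of x] show ?thesis by (simp add: mollify_def)
qed

lemma mollify_integrand_integrable:
  assumes "continuous_on UNIV f" "mollifier \<epsilon> \<rho>"
  shows "integrable lborel (\<lambda>y. f (x - y) * \<rho> y)"
proof (rule bounded_support_integrable[of _ "ball 0 \<epsilon>"])
  show "continuous_on UNIV (\<lambda>y. f (x - y) * \<rho> y)"
    by (intro continuous_intros continuous_on_compose2[OF assms(1)])
      (use assms(2) flat_algebra_continuous in \<open>auto simp: mollifier_def\<close>)
qed (use assms(2) in \<open>auto simp: mollifier_def\<close>)

text \<open>Writing both mollifications as averages of \<open>f (x - y)\<close> and \<open>g (z - y)\<close> with the same weight \<open>\<rho> y\<close>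
reduces the claim to the integrands. Taking \<open>g\<close> constant gives approximation of \<open>f\<close>; taking
\<open>g = f\<close> and different base points gives preservation of Lipschitz constants.\<close>
lemma mollify_diff_bound:
  fixes f g :: "'a::euclidean_space \<Rightarrow> real"
  assumes f: "continuous_on UNIV f" and g: "continuous_on UNIV g"
    and \<rho>: "mollifier \<epsilon> \<rho>"
    and b: "\<And>y. norm y < \<epsilon> \<Longrightarrow> \<bar>f (x - y) - g (z - y)\<bar> \<le> \<eta>"
  shows "\<bar>mollify \<rho> f x - mollify \<rho> g z\<bar> \<le> \<eta>"
proof -
  have r: "continuous_on UNIV \<rho>" "integrable lborel \<rho>" "integral\<^sup>L lborel \<rho> = 1"
    "\<And>z. 0 \<le> \<rho> z" "\<And>z. \<epsilon> \<le> norm z \<Longrightarrow> \<rho> z = 0"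
    using \<rho> flat_algebra_continuous by (auto simp: mollifier_def)
  note int = mollify_integrand_integrable[OF f \<rho>, of x] mollify_integrand_integrable[OF g \<rho>, of z]
  have "mollify \<rho> f x - mollify \<rho> g z = (\<integral>y. f (x - y) * \<rho> y - g (z - y) * \<rho> y \<partial>lborel)"
    unfolding mollify_commute[OF f r(1)] mollify_commute[OF g r(1)] using int by simp
  also have "\<bar>\<dots>\<bar> \<le> (\<integral>y. \<bar>f (x - y) * \<rho> y - g (z - y) * \<rho> y\<bar> \<partial>lborel)"
    by (rule integral_abs_bound)
  also have "\<dots> \<le> (\<integral>y. \<eta> * \<rho> y \<partial>lborel)"
  proof (rule integral_mono)
    fix y show "\<bar>f (x - y) * \<rho> y - g (z - y) * \<rho> y\<bar> \<le> \<eta> * \<rho> y"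
    proof (cases "norm y < \<epsilon>")
      case True
      have "\<bar>f (x - y) * \<rho> y - g (z - y) * \<rho> y\<bar> = \<bar>f (x - y) - g (z - y)\<bar> * \<rho> y"
        using r(4)[of y] by (simp add: abs_mult flip: left_diff_distrib)
      then show ?thesis using mult_right_mono[OF b[OF True] r(4)[of y]] by simp
    qed (use r(5) in simp)
  qed (use int r in auto)
  also have "\<dots> = \<eta>" using r by simp
  finally show ?thesis .
qed

lemma mollify_const: "mollifier \<epsilon> \<rho> \<Longrightarrow> mollify \<rho> (\<lambda>_. c) x = c"
  using mollify_commute[of "\<lambda>_. c" \<rho> x] flat_algebra_continuous by (auto simp: mollifier_def)

section \<open>Weak gradients bounded by one and Lipschitz continuity\<close>
lemma open_in_lebesgue: "open S \<Longrightarrow> S \<in> sets lebesgue"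
  by (simp add: sets_completionI_sets)

lemma locally_integrable_bounded:
  fixes f :: "'a::euclidean_space \<Rightarrow> real"
  assumes "f \<in> borel_measurable borel" "\<And>x. \<bar>f x\<bar> \<le> B"
  shows "locally_integrable \<Omega> f"
  unfolding locally_integrable_def
proof (intro allI impI)
  fix K assume "compact K \<and> K \<subseteq> \<Omega>"
  then interpret finite_measure "lebesgue_on K"
    by (simp add: finite_measure_lebesgue_on lmeasurable_compact)
  have "f \<in> borel_measurable (lebesgue_on K)"
    using assms(1) by (simp add: measurable_completion measurable_restrict_space1)
  then show "integrable (lebesgue_on K) f"
    by (rule integrable_const_bound[rotated, of _ B]) (use assms(2) in simp)
qed

lemma integral_lebesgue_on_eq_lborel:
  fixes g :: "'a::euclidean_space \<Rightarrow> real"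
  assumes "S \<in> sets lebesgue" "g \<in> borel_measurable borel"
    and "\<And>x. x \<in> S \<Longrightarrow> f x = g x" "\<And>x. x \<notin> S \<Longrightarrow> g x = 0"
  shows "integral\<^sup>L (lebesgue_on S) f = integral\<^sup>L lborel g"
proof -
  have "integral\<^sup>L (lebesgue_on S) f = integral\<^sup>L lebesgue (\<lambda>x. indicator S x *\<^sub>R f x)"
    using assms(1) by (simp add: integral_restrict_space)
  also have "(\<lambda>x. indicator S x *\<^sub>R f x) = g"
    using assms(3,4) by (auto simp: indicator_def fun_eq_iff)
  also have "integral\<^sup>L lebesgue g = integral\<^sup>L lborel g"
    using assms(2) by (simp add: integral_completion)
  finally show ?thesis .
qed

lemma locally_integrable_mult_integrable:
  fixes v \<phi> :: "'a::euclidean_space \<Rightarrow> real"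
  assumes v: "locally_integrable \<Omega> v" and \<phi>: "continuous_on UNIV \<phi>"
    and K: "compact K" "K \<subseteq> \<Omega>" "\<And>x. x \<notin> K \<Longrightarrow> \<phi> x = 0" and \<Omega>: "\<Omega> \<in> sets lebesgue"
  shows "integrable (lebesgue_on \<Omega>) (\<lambda>x. v x * \<phi> x)"
proof -
  have "integrable (lebesgue_on K) v" using v K by (simp add: locally_integrable_def)
  moreover have Kl: "K \<in> sets lebesgue" using K(1) by (simp add: lmeasurable_compact fmeasurableD)
  ultimately have i: "integrable lebesgue (\<lambda>x. indicator K x *\<^sub>R v x)"
    by (simp add: integrable_restrict_space)
  have "bounded (\<phi> ` K)"
    by (intro compact_imp_bounded compact_continuous_image continuous_on_subset[OF \<phi>] K(1)) simp
  then obtain B where B: "\<And>x. x \<in> K \<Longrightarrow> \<bar>\<phi> x\<bar> \<le> B" by (auto simp: bounded_iff)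
  have [measurable]: "\<phi> \<in> borel_measurable lebesgue"
    using \<phi> by (simp add: borel_measurable_continuous_onI measurable_completion)
  have [measurable]: "(\<lambda>x. indicator K x *\<^sub>R v x) \<in> borel_measurable lebesgue" using i by simp
  have "integrable lebesgue (\<lambda>x. (indicator K x *\<^sub>R v x) * \<phi> x)"
  proof (rule Bochner_Integration.integrable_bound[OF integrable_mult_right[OF i, of B]])
    show "AE x in lebesgue. norm (indicator K x *\<^sub>R v x * \<phi> x) \<le> norm (B * indicator K x *\<^sub>R v x)"
    proof (intro always_eventually allI)
      fix x show "norm (indicator K x *\<^sub>R v x * \<phi> x) \<le> norm (B * indicator K x *\<^sub>R v x)"
        using B[of x] by (cases "x \<in> K") (auto simp: abs_mult mult.commute[of "\<bar>v x\<bar>"] intro!: mult_right_mono)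
    qed
  qed measurable
  also have "(\<lambda>x. (indicator K x *\<^sub>R v x) * \<phi> x) = (\<lambda>x. indicator \<Omega> x *\<^sub>R (v x * \<phi> x))"
    using K by (auto simp: indicator_def fun_eq_iff)
  finally show ?thesis using \<Omega> by (simp add: integrable_restrict_space)
qed

text \<open>The boundary values make the extension by zero continuous on the whole space, so that mollification
applies to it.\<close>
lemma zero_extension_continuous:
  fixes u :: "'a::euclidean_space \<Rightarrow> real"
  assumes "open \<Omega>" "continuous_on (closure \<Omega>) u" "\<forall>x\<in>frontier \<Omega>. u x = 0"
  shows "continuous_on UNIV (\<lambda>x. if x \<in> \<Omega> then u x else 0)"
proof -
  have "continuous_on (closure \<Omega> \<union> - \<Omega>) (\<lambda>x. if x \<in> \<Omega> then u x else 0)"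
    by (rule continuous_on_cases)
      (use assms in \<open>auto simp: closed_Compl frontier_def interior_open\<close>)
  moreover have "closure \<Omega> \<union> - \<Omega> = UNIV" using closure_subset by blast
  ultimately show ?thesis by simp
qed

lemma flat_algebra_frechet_derivative_reflect:
  assumes "flat_algebra \<rho>"
  shows "frechet_derivative (\<lambda>y. \<rho> (p - y)) (at y) e = - frechet_derivative \<rho> (at (p - y)) e"
proof -
  have "((\<lambda>y. p - y) has_derivative (\<lambda>e. - e)) (at y)"
    by (auto intro!: derivative_eq_intros)
  from has_derivative_compose[OF this flat_algebra_derivative(1)[OF assms]]
  have "((\<lambda>y. \<rho> (p - y)) has_derivative (\<lambda>e. frechet_derivative \<rho> (at (p - y)) (- e))) (at y)" .
  then have "frechet_derivative (\<lambda>y. \<rho> (p - y)) (at y) e = frechet_derivative \<rho> (at (p - y)) (- e)"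
    using frechet_derivative_at by metis
  then show ?thesis
    using linear_neg[OF has_derivative_linear[OF flat_algebra_derivative(1)[OF assms]]] by simp
qed

lemma frechet_derivative_components:
  fixes f :: "'a::euclidean_space \<Rightarrow> real"
  assumes "(f has_derivative frechet_derivative f (at x)) (at x)"
  shows "frechet_derivative f (at x) e = (\<Sum>i\<in>Basis. (e \<bullet> i) * frechet_derivative f (at x) i)"
proof -
  have l: "linear (frechet_derivative f (at x))" using assms by (rule has_derivative_linear)
  have "frechet_derivative f (at x) e = frechet_derivative f (at x) (\<Sum>i\<in>Basis. (e \<bullet> i) *\<^sub>R i)"
    by (simp add: euclidean_representation)
  then show ?thesis by (simp add: linear_sum[OF l] linear_cmul[OF l])
qed

text \<open>The kernel \<open>y \<mapsto> \<rho> (p - y)\<close> is a test function in \<open>\<Omega>\<close>. Testing the weak derivative with it moves the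
derivative from the kernel to \<open>u\<close>: the directional derivative of the mollification at \<open>p\<close> is the
average of \<open>G \<bullet> e\<close> against a probability density, hence at most \<open>norm e\<close>.\<close>
lemma weak_gradient_mollify_bound:
  fixes u :: "'a::euclidean_space \<Rightarrow> real"
  assumes \<Omega>: "open \<Omega>" and u: "continuous_on (closure \<Omega>) u" "\<forall>x\<in>frontier \<Omega>. u x = 0"
    and G: "has_weak_gradient \<Omega> u G" "AE x in lebesgue_on \<Omega>. norm (G x) \<le> 1"
    and \<rho>: "mollifier \<epsilon> \<rho>" and p: "cball p \<epsilon> \<subseteq> \<Omega>"
  shows "\<bar>mollify (\<lambda>z. frechet_derivative \<rho> (at z) e) (\<lambda>x. if x \<in> \<Omega> then u x else 0) p\<bar> \<le> norm e"
proof -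
  let ?u = "\<lambda>x. if x \<in> \<Omega> then u x else 0"
  let ?\<phi> = "\<lambda>y. \<rho> (p - y)"
  have cu: "continuous_on UNIV ?u" by (rule zero_extension_continuous[OF \<Omega> u])
  have \<Omega>l: "\<Omega> \<in> sets lebesgue" using \<Omega> by (rule open_in_lebesgue)
  have fr: "flat_algebra \<rho>" and r: "\<And>z. 0 \<le> \<rho> z" "\<And>z. \<epsilon> \<le> norm z \<Longrightarrow> \<rho> z = 0"
    "integral\<^sup>L lborel \<rho> = 1"
    using \<rho> by (auto simp: mollifier_def)
  have f\<phi>: "flat_algebra ?\<phi>" using fr by (rule flat_algebra_reflect)
  have c\<phi>: "continuous_on UNIV ?\<phi>" by (rule flat_algebra_continuous[OF f\<phi>])
  have z\<phi>: "?\<phi> y = 0" if "y \<notin> cball p \<epsilon>" for y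
    using r(2)[of "p - y"] that by (simp add: dist_norm)
  have z\<phi>': "?\<phi> y = 0" if "y \<notin> \<Omega>" for y
    using z\<phi>[of y] subsetD[OF p, of y] that by linarith
  have T: "?\<phi> \<in> test_functions \<Omega>"
    by (rule flat_algebra_test_function[OF f\<phi> compact_cball p z\<phi>])
  have conv: "(LINT y|lebesgue_on \<Omega>. u y * g y) = (\<integral>y. ?u y * g y \<partial>lborel)"
    if "continuous_on UNIV g" for g
    by (rule integral_lebesgue_on_eq_lborel[OF \<Omega>l])
      (auto intro!: borel_measurable_continuous_onI continuous_intros cu that)
  have cD: "continuous_on UNIV (\<lambda>y. frechet_derivative \<rho> (at (p - y)) i)" for i
    by (rule flat_algebra_continuous[OF flat_algebra_reflect[OF flat_algebra_derivative(2)[OF fr]]])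
  have iD: "integrable lborel (\<lambda>y. ?u y * frechet_derivative \<rho> (at (p - y)) i)" for i
  proof (rule bounded_support_integrable[of _ "cball p \<epsilon>"])
    fix y assume y: "y \<notin> cball p \<epsilon>"
    have "(?\<phi> has_derivative (\<lambda>_. 0)) (at y)"
    proof (rule has_derivative_transform_within_open[of "\<lambda>_. 0" _ _ _ "- cball p \<epsilon>"])
      show "\<And>x. x \<in> - cball p \<epsilon> \<Longrightarrow> 0 = ?\<phi> x" using z\<phi> by auto
    qed (use y in auto)
    then have "frechet_derivative ?\<phi> (at y) i = 0" using frechet_derivative_at by metis
    then show "?u y * frechet_derivative \<rho> (at (p - y)) i = 0"
      using flat_algebra_frechet_derivative_reflect[OF fr, of p y i] by simp
  qed (auto intro!: continuous_intros cu cD)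
  have wp: "(\<integral>y. ?u y * frechet_derivative \<rho> (at (p - y)) i \<partial>lborel)
      = (LINT y|lebesgue_on \<Omega>. (G y \<bullet> i) * ?\<phi> y)" if "i \<in> Basis" for i
  proof -
    have "(LINT x|lebesgue_on \<Omega>. u x * frechet_derivative ?\<phi> (at x) i) =
        - (LINT x|lebesgue_on \<Omega>. (G x \<bullet> i) * ?\<phi> x)"
      using G(1) that T unfolding has_weak_gradient_def has_weak_partial_def by blast
    then show ?thesis
      using conv[OF cD] by (simp add: flat_algebra_frechet_derivative_reflect[OF fr])
  qed
  have iG: "integrable (lebesgue_on \<Omega>) (\<lambda>y. (G y \<bullet> i) * ?\<phi> y)" if "i \<in> Basis" for i
    by (rule locally_integrable_mult_integrable[OF _ c\<phi> compact_cball p z\<phi> \<Omega>l])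
      (use G(1) that in \<open>simp add: has_weak_gradient_def has_weak_partial_def\<close>)
  have Ge: "(G y \<bullet> e) * ?\<phi> y = (\<Sum>i\<in>Basis. (e \<bullet> i) * ((G y \<bullet> i) * ?\<phi> y))" for y
    unfolding euclidean_inner[of "G y" e] sum_distrib_right by (intro sum.cong refl) (simp add: mult_ac)
  have "mollify (\<lambda>z. frechet_derivative \<rho> (at z) e) ?u p
      = (\<integral>y. (\<Sum>i\<in>Basis. (e \<bullet> i) * (?u y * frechet_derivative \<rho> (at (p - y)) i)) \<partial>lborel)"
    unfolding mollify_def
    by (subst frechet_derivative_components[OF flat_algebra_derivative(1)[OF fr]])
      (simp only: sum_distrib_left mult_ac)
  also have "\<dots> = (\<Sum>i\<in>Basis. (e \<bullet> i) * (LINT y|lebesgue_on \<Omega>. (G y \<bullet> i) * ?\<phi> y))"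
    using iD wp by (subst Bochner_Integration.integral_sum) (auto simp del: mult_cancel_left)
  also have "\<dots> = (LINT y|lebesgue_on \<Omega>. (G y \<bullet> e) * ?\<phi> y)"
    unfolding Ge using iG by (subst Bochner_Integration.integral_sum) auto
  also have "\<bar>\<dots>\<bar> \<le> (LINT y|lebesgue_on \<Omega>. \<bar>(G y \<bullet> e) * ?\<phi> y\<bar>)"
    by (rule integral_abs_bound)
  also have "\<dots> \<le> (LINT y|lebesgue_on \<Omega>. norm e * ?\<phi> y)"
  proof (rule integral_mono_AE)
    show "integrable (lebesgue_on \<Omega>) (\<lambda>y. \<bar>(G y \<bullet> e) * ?\<phi> y\<bar>)"
      unfolding Ge using iG by auto
    show "integrable (lebesgue_on \<Omega>) (\<lambda>y. norm e * ?\<phi> y)"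
    proof (rule locally_integrable_mult_integrable[OF _ c\<phi> compact_cball p z\<phi> \<Omega>l])
      show "locally_integrable \<Omega> (\<lambda>_. norm e)"
        by (rule locally_integrable_bounded[of _ "norm e"]) auto
    qed
    show "AE y in lebesgue_on \<Omega>. \<bar>(G y \<bullet> e) * ?\<phi> y\<bar> \<le> norm e * ?\<phi> y"
      using G(2)
    proof eventually_elim
      case (elim y)
      have "\<bar>G y \<bullet> e\<bar> \<le> norm (G y) * norm e" by (rule Cauchy_Schwarz_ineq2)
      also have "\<dots> \<le> norm e" using elim by (simp add: mult_left_le_one_le)
      finally show ?case using r(1)[of "p - y"] by (simp add: abs_mult mult_right_mono)
    qed
  qed
  also have "\<dots> = (\<integral>y. norm e * ?\<phi> y \<partial>lborel)"
  proof (rule integral_lebesgue_on_eq_lborel[OF \<Omega>l])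
    show "(\<lambda>y. norm e * ?\<phi> y) \<in> borel_measurable borel"
      by (intro borel_measurable_continuous_onI continuous_intros c\<phi>)
    show "norm e * ?\<phi> y = 0" if "y \<notin> \<Omega>" for y using z\<phi>'[OF that] by simp
  qed simp
  also have "\<dots> = norm e * (\<integral>y. ?\<phi> y \<partial>lborel)" by simp
  also have "(\<integral>y. ?\<phi> y \<partial>lborel) = 1"
    using lborel_integral_reflect[of \<rho> p] r(3) flat_algebra_continuous[OF fr, of UNIV]
    by (simp add: borel_measurable_continuous_onI)
  finally show ?thesis by simp
qed

text \<open>On a slightly smaller concentric ball the mollifications have derivative at most one, so the mean
value theorem along the segment from \<open>x\<close> to \<open>z\<close> makes them 1-Lipschitz there; they converge
pointwise to \<open>u\<close>. A ball is needed because the segment must keep a positive distance from the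
boundary.\<close>
lemma weak_gradient_imp_lipschitz:
  fixes u :: "'a::euclidean_space \<Rightarrow> real"
  assumes \<Omega>: "open \<Omega>" "bounded \<Omega>" and u: "continuous_on (closure \<Omega>) u" "\<forall>x\<in>frontier \<Omega>. u x = 0"
    and G: "has_weak_gradient \<Omega> u G" "AE x in lebesgue_on \<Omega>. norm (G x) \<le> 1"
    and B: "ball c r \<subseteq> \<Omega>" "x \<in> ball c r" "z \<in> ball c r"
  shows "\<bar>u x - u z\<bar> \<le> norm (x - z)"
proof (rule field_le_epsilon)
  fix \<eta> :: real assume "\<eta> > 0"
  let ?u = "\<lambda>x. if x \<in> \<Omega> then u x else 0"
  have cu: "continuous_on UNIV ?u" by (rule zero_extension_continuous[OF \<Omega>(1) u])
  have close: "\<exists>d>0. \<forall>y. norm y < d \<longrightarrow> \<bar>?u (q - y) - ?u q\<bar> \<le> \<eta> / 2" for q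
  proof -
    have "isCont ?u q" using cu by (simp add: continuous_on_eq_continuous_at)
    then obtain d where "d > 0" and d: "\<And>y. dist y q < d \<Longrightarrow> dist (?u y) (?u q) < \<eta> / 2"
      using \<open>\<eta> > 0\<close> unfolding continuous_at_eps_delta by (meson half_gt_zero)
    then have "\<bar>?u (q - y) - ?u q\<bar> < \<eta> / 2" if "norm y < d" for y
      using d[of "q - y"] that by (simp only: dist_real_def) (simp add: dist_norm)
    then show ?thesis using \<open>d > 0\<close> less_imp_le by blast
  qed
  obtain d1 d2 where d: "d1 > 0" "\<And>y. norm y < d1 \<Longrightarrow> \<bar>?u (x - y) - ?u x\<bar> \<le> \<eta> / 2"
      "d2 > 0" "\<And>y. norm y < d2 \<Longrightarrow> \<bar>?u (z - y) - ?u z\<bar> \<le> \<eta> / 2"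
    using close[of x] close[of z] by metis
  \<comment> \<open>The segment lies in \<open>cball c s\<close>, so kernels of radius below \<open>r - s\<close> stay inside \<open>\<Omega>\<close>.\<close>
  define s where "s = max (dist c x) (dist c z)"
  define \<epsilon> where "\<epsilon> = min (min d1 d2) ((r - s) / 2)"
  have s: "s < r" using B by (simp add: s_def)
  then have \<epsilon>: "\<epsilon> > 0" "\<epsilon> \<le> d1" "\<epsilon> \<le> d2" "\<epsilon> < r - s" using d(1,3) by (auto simp: \<epsilon>_def min_def)
  obtain \<rho> :: "'a \<Rightarrow> real" where \<rho>: "mollifier \<epsilon> \<rho>" using mollifier_exists[OF \<epsilon>(1)] by blast
  let ?U = "mollify \<rho> ?u" and ?e = "z - x"
  have D: "((\<lambda>t. ?U (x + t *\<^sub>R ?e)) has_real_derivative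
      mollify (\<lambda>z. frechet_derivative \<rho> (at z) ?e) ?u (x + t *\<^sub>R ?e)) (at t)" for t
    by (rule mollify_has_derivative[OF cu \<Omega>(2)]) (use \<rho> in \<open>auto simp: mollifier_def\<close>)
  obtain t where t: "0 < t" "t < 1" "?U (x + 1 *\<^sub>R ?e) - ?U (x + 0 *\<^sub>R ?e) =
      (1 - 0) * mollify (\<lambda>z. frechet_derivative \<rho> (at z) ?e) ?u (x + t *\<^sub>R ?e)"
    using MVT2[of 0 1, OF _ D] by auto
  let ?p = "x + t *\<^sub>R ?e"
  have "?p \<in> cball c s"
  proof -
    have "?p = (1 - t) *\<^sub>R x + t *\<^sub>R z" by (simp add: algebra_simps)
    then show ?thesis
      using convexD_alt[OF convex_cball[of c s], of x z t] t by (simp add: s_def)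
  qed
  then have "cball ?p \<epsilon> \<subseteq> \<Omega>"
  proof -
    have "dist c y < r" if "dist ?p y \<le> \<epsilon>" for y
      using dist_triangle[of c y ?p] that \<open>?p \<in> cball c s\<close> \<epsilon>(4) by simp
    then show ?thesis using B(1) by (auto simp: subset_iff)
  qed
  then have "\<bar>?U z - ?U x\<bar> \<le> norm ?e"
    using weak_gradient_mollify_bound[OF \<Omega>(1) u G \<rho>, of ?p ?e] t(3) by simp
  then have e: "\<bar>?U z - ?U x\<bar> \<le> norm (x - z)" by (simp only: norm_minus_commute[of x z])
  have x: "\<bar>?U x - ?u x\<bar> \<le> \<eta> / 2"
    using mollify_diff_bound[OF cu _ \<rho>, where g="\<lambda>_. ?u x" and x=x and z=x and \<eta>="\<eta> / 2"] mollify_const[OF \<rho>] d(2) \<epsilon> by simp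
  have z: "\<bar>?U z - ?u z\<bar> \<le> \<eta> / 2"
    using mollify_diff_bound[OF cu _ \<rho>, where g="\<lambda>_. ?u z" and x=z and z=z and \<eta>="\<eta> / 2"] mollify_const[OF \<rho>] d(4) \<epsilon> by simp
  have tri: "\<bar>c - d\<bar> \<le> n + h" if "\<bar>b - a\<bar> \<le> n" "\<bar>a - c\<bar> \<le> h / 2" "\<bar>b - d\<bar> \<le> h / 2" for a b c d n h :: real
    using that by linarith
  have "x \<in> \<Omega>" "z \<in> \<Omega>" using B by auto
  then have "?u x = u x" "?u z = u z" by simp_all
  then show "\<bar>u x - u z\<bar> \<le> norm (x - z) + \<eta>" using tri[OF e x z] by (simp only:)
qed

section \<open>Almost everywhere uniqueness of the weak gradient\<close>
lemma flat_0_bounds: "0 \<le> flat 0 t" "flat 0 t \<le> 1"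
  by (auto simp: flat_def)

text \<open>Since \<open>flat 0 (n s)\<close> increases to one for \<open>s > 0\<close> and vanishes for \<open>s \<le> 0\<close>, the product of these factors
over the faces of the box converges boundedly to the indicator of its interior.\<close>
lemma box_cutoff:
  fixes a b :: "'a::euclidean_space"
  obtains \<phi> :: "nat \<Rightarrow> 'a \<Rightarrow> real" where "\<And>n. flat_algebra (\<phi> n)" "\<And>n x. \<bar>\<phi> n x\<bar> \<le> 1"
    "\<And>n x. x \<notin> cbox a b \<Longrightarrow> \<phi> n x = 0" "\<And>x. (\<lambda>n. \<phi> n x) \<longlonglongrightarrow> indicator (box a b) x"
proof
  define \<theta> :: "nat \<Rightarrow> 'a \<Rightarrow> 'a \<Rightarrow> real" where "\<theta> n i x = flat 0 (real (Suc n) * (x \<bullet> i - a \<bullet> i)) * flat 0 (real (Suc n) * (b \<bullet> i - x \<bullet> i))"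
    for n i x
  define \<phi> where "\<phi> n x = (\<Prod>i\<in>Basis. \<theta> n i x)" for n x
  have \<theta>: "0 \<le> \<theta> n i x" "\<theta> n i x \<le> 1" for n i x
    unfolding \<theta>_def by (auto intro!: mult_le_one flat_0_bounds mult_nonneg_nonneg)
  have \<theta>0: "\<theta> n i x = 0" if "\<not> (a \<bullet> i < x \<bullet> i \<and> x \<bullet> i < b \<bullet> i)" for n i x
    using that by (auto simp: \<theta>_def flat_def zero_less_mult_iff)
  show "flat_algebra (\<phi> n)" for n
    unfolding \<phi>_def \<theta>_def
    by (intro flat_algebra_prod flat_algebra.mult flat_algebra.flat flat_algebra_diff
          flat_algebra.const flat_algebra.coord) auto
  show "\<bar>\<phi> n x\<bar> \<le> 1" for n x
  proof -
    have "0 \<le> \<phi> n x" unfolding \<phi>_def by (intro prod_nonneg \<theta>)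
    moreover have "\<phi> n x \<le> 1" unfolding \<phi>_def by (intro prod_le_1 conjI \<theta>)
    ultimately show ?thesis by simp
  qed
  have \<phi>0: "\<phi> n x = 0" if "x \<notin> box a b" for n x
  proof -
    obtain i where "i \<in> Basis" "\<not> (a \<bullet> i < x \<bullet> i \<and> x \<bullet> i < b \<bullet> i)" using \<open>x \<notin> box a b\<close> unfolding mem_box by blast
    then have "\<exists>i\<in>Basis. \<theta> n i x = 0" using \<theta>0 by blast
    then show ?thesis by (simp add: \<phi>_def prod_zero_iff)
  qed
  then show "\<phi> n x = 0" if "x \<notin> cbox a b" for n x
    using that box_subset_cbox by blast
  show "(\<lambda>n. \<phi> n x) \<longlonglongrightarrow> indicator (box a b) x" for x
  proof (cases "x \<in> box a b")
    case True
    have F: "(\<lambda>n. flat 0 (real (Suc n) * s)) \<longlonglongrightarrow> 1" if "s > 0" for s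
    proof -
      have "(\<lambda>n. exp (- (inverse (real (Suc n)) * inverse s))) \<longlonglongrightarrow> exp (- (0 * inverse s))"
        by (intro tendsto_intros LIMSEQ_inverse_real_of_nat)
      then show ?thesis using that by (simp add: flat_def)
    qed
    have "(\<lambda>n. \<phi> n x) \<longlonglongrightarrow> (\<Prod>i\<in>(Basis::'a set). 1 * 1)"
      unfolding \<phi>_def \<theta>_def
      by (intro tendsto_prod tendsto_mult F) (use True in \<open>auto simp: mem_box\<close>)
    then show ?thesis using True by simp
  qed (simp add: \<phi>0)
qed

lemma fundamental_lemma_box:
  fixes f :: "'a::euclidean_space \<Rightarrow> real"
  assumes \<Omega>: "open \<Omega>" and f: "locally_integrable \<Omega> f"
    and test: "\<And>\<phi>. \<phi> \<in> test_functions \<Omega> \<Longrightarrow> (LINT x|lebesgue_on \<Omega>. f x * \<phi> x) = 0"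
    and ab: "cbox a b \<subseteq> \<Omega>"
  shows "integral (cbox a b) f = 0"
proof -
  obtain \<phi> :: "nat \<Rightarrow> 'a \<Rightarrow> real" where \<phi>: "\<And>n. flat_algebra (\<phi> n)" "\<And>n x. \<bar>\<phi> n x\<bar> \<le> 1"
    "\<And>n x. x \<notin> cbox a b \<Longrightarrow> \<phi> n x = 0" "\<And>x. (\<lambda>n. \<phi> n x) \<longlonglongrightarrow> indicator (box a b) x"
    using box_cutoff by blast
  have i: "integrable (lebesgue_on (cbox a b)) f"
    using f ab by (simp add: locally_integrable_def)
  have fm: "f \<in> borel_measurable (lebesgue_on (cbox a b))" using i by simp
  have \<phi>m: "\<phi> n \<in> borel_measurable (lebesgue_on (cbox a b))" for n
    using flat_algebra_continuous[OF \<phi>(1), of UNIV n]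
    by (simp add: borel_measurable_continuous_onI measurable_completion measurable_restrict_space1)
  have Z: "(LINT x|lebesgue_on (cbox a b). f x * \<phi> n x) = 0" for n
  proof -
    have "(LINT x|lebesgue_on \<Omega>. f x * \<phi> n x) = 0"
      by (intro test flat_algebra_test_function[OF \<phi>(1) compact_cbox ab \<phi>(3)])
    moreover have "(\<lambda>x. indicator \<Omega> x *\<^sub>R (f x * \<phi> n x)) = (\<lambda>x. indicator (cbox a b) x *\<^sub>R (f x * \<phi> n x))"
      using \<phi>(3)[of _ n] ab by (auto simp: indicator_def fun_eq_iff)
    ultimately show ?thesis
      using open_in_lebesgue[OF \<Omega>] by (simp add: integral_restrict_space)
  qed
  have "(\<lambda>n. LINT x|lebesgue_on (cbox a b). f x * \<phi> n x) \<longlonglongrightarrow>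
      (LINT x|lebesgue_on (cbox a b). f x * indicator (box a b) x)"
  proof (rule integral_dominated_convergence[where w="\<lambda>x. \<bar>f x\<bar>"])
    show "AE x in lebesgue_on (cbox a b). norm (f x * \<phi> n x) \<le> \<bar>f x\<bar>" for n
      using \<phi>(2)[of n] by (intro always_eventually) (simp add: abs_mult mult_left_le)
    show "AE x in lebesgue_on (cbox a b). (\<lambda>n. f x * \<phi> n x) \<longlonglongrightarrow> f x * indicator (box a b) x"
      using \<phi>(4) by (intro always_eventually allI tendsto_intros)
    have "(indicator (box a b) :: 'a \<Rightarrow> real) \<in> borel_measurable (lebesgue_on (cbox a b))"
      by (intro measurable_restrict_space1 measurable_completion) simp
    then show "(\<lambda>x. f x * indicator (box a b) x) \<in> borel_measurable (lebesgue_on (cbox a b))"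
      using fm by (rule borel_measurable_times[rotated])
  qed (use i fm \<phi>m in auto)
  then have "(LINT x|lebesgue_on (cbox a b). f x * indicator (box a b) x) = 0"
    by (simp add: Z LIMSEQ_const_iff)
  also have "(LINT x|lebesgue_on (cbox a b). f x * indicator (box a b) x)
     = (LINT x|lebesgue_on (box a b). f x)"
    using box_subset_cbox[of a b]
    by (auto simp: integral_restrict_space indicator_def intro!: Bochner_Integration.integral_cong)
  also have "\<dots> = integral (box a b) f"
  proof (rule lebesgue_integral_eq_integral)
    have "integrable lebesgue (\<lambda>x. indicator (cbox a b) x *\<^sub>R f x)"
      using i by (simp add: integrable_restrict_space)
    then have "integrable lebesgue (\<lambda>x. indicator (box a b) x *\<^sub>R (indicator (cbox a b) x *\<^sub>R f x))"
      by (rule integrable_mult_indicator[rotated]) simp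
    moreover have "(\<lambda>x. indicator (box a b) x *\<^sub>R (indicator (cbox a b) x *\<^sub>R f x))
        = (\<lambda>x. indicator (box a b) x *\<^sub>R f x)"
      using box_subset_cbox[of a b] by (auto simp: indicator_def fun_eq_iff)
    ultimately show "integrable (lebesgue_on (box a b)) f"
      by (simp add: integrable_restrict_space)
  qed simp
  finally show ?thesis by (simp add: integral_open_interval)
qed

text \<open>The cutoffs give vanishing integrals over all boxes compactly contained in \<open>\<Omega>\<close>. By Lebesgue's
differentiation theorem a function is almost everywhere the limit of its averages over small cubes,
all of which vanish here; finally \<open>\<Omega>\<close> is a countable union of such boxes.\<close>
lemma fundamental_lemma:
  fixes f :: "'a::euclidean_space \<Rightarrow> real"
  assumes \<Omega>: "open \<Omega>" and f: "locally_integrable \<Omega> f"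
    and test: "\<And>\<phi>. \<phi> \<in> test_functions \<Omega> \<Longrightarrow> (LINT x|lebesgue_on \<Omega>. f x * \<phi> x) = 0"
  shows "AE x in lebesgue_on \<Omega>. f x = 0"
proof -
  have local: "negligible {x \<in> cbox a b. f x \<noteq> 0}" if ab: "cbox a b \<subseteq> \<Omega>" for a b
  proof -
    let ?g = "\<lambda>x. if x \<in> cbox a b then f x else 0"
    have "integrable (lebesgue_on (cbox a b)) f"
      using f ab by (simp add: locally_integrable_def)
    then have "f integrable_on cbox a b" by (simp add: integrable_on_lebesgue_on)
    then have "?g integrable_on UNIV" by (simp add: integrable_restrict_UNIV)
    then have "?g integrable_on cbox c d" for c d
      by (rule integrable_on_subcbox) simp
    then obtain N where N: "negligible N" "\<And>x e. \<lbrakk>x \<notin> N; 0 < e\<rbrakk> \<Longrightarrow>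
        \<exists>d>0. \<forall>h. 0 < h \<and> h < d \<longrightarrow> norm (integral (cbox x (x + h *\<^sub>R One)) ?g /\<^sub>R h ^ DIM('a) - ?g x) < e"
      using integrable_ccontinuous_explicit[of ?g] by blast
    have "f x = 0" if x: "x \<in> box a b" "x \<notin> N" for x
    proof (rule ccontr)
      assume "f x \<noteq> 0"
      then obtain d where d: "d > 0" "\<And>h. 0 < h \<Longrightarrow> h < d \<Longrightarrow>
          norm (integral (cbox x (x + h *\<^sub>R One)) ?g /\<^sub>R h ^ DIM('a) - ?g x) < \<bar>f x\<bar>"
        using N(2)[OF x(2), of "\<bar>f x\<bar>"] by auto
      have "isCont (\<lambda>h. x + h *\<^sub>R One) 0" by (intro continuous_intros)
      then have "((\<lambda>h. x + h *\<^sub>R One) \<longlongrightarrow> x) (at 0)" by (simp add: isCont_def)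
      then have "((\<lambda>h. x + h *\<^sub>R One) \<longlongrightarrow> x) (at_right 0)" by (simp add: filterlim_at_split)
      then have "eventually (\<lambda>h. x + h *\<^sub>R One \<in> box a b) (at_right 0)"
        by (rule topological_tendstoD[OF _ open_box x(1)])
      moreover have "eventually (\<lambda>h. 0 < h \<and> h < d) (at_right 0)"
        using d(1) by (auto simp: eventually_at_right_field)
      ultimately have "eventually (\<lambda>h. x + h *\<^sub>R One \<in> box a b \<and> 0 < h \<and> h < d) (at_right 0)"
        by eventually_elim auto
      then obtain h where h: "x + h *\<^sub>R One \<in> box a b" "0 < h" "h < d"
        using eventually_happens' trivial_limit_at_right_real by (metis (mono_tags, lifting))
      have sub: "cbox x (x + h *\<^sub>R One) \<subseteq> cbox a b"
        using h(1) x(1) by (fastforce simp: subset_box mem_box intro: less_imp_le)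
      have "integral (cbox x (x + h *\<^sub>R One)) ?g = integral (cbox x (x + h *\<^sub>R One)) f"
        using sub by (intro Henstock_Kurzweil_Integration.integral_cong) auto
      also have "\<dots> = 0"
        using fundamental_lemma_box[OF \<Omega> f test] sub ab by blast
      finally show False using d(2)[OF h(2,3)] x(1) box_subset_cbox[of a b] by auto
    qed
    then have "{x \<in> cbox a b. f x \<noteq> 0} \<subseteq> N \<union> (cbox a b - box a b)" by auto
    moreover have "negligible (cbox a b - box a b)" by (rule negligible_frontier_interval)
    ultimately show ?thesis using N(1) negligible_Un negligible_subset by blast
  qed
  obtain \<D> where \<D>: "countable \<D>" "\<D> \<subseteq> Pow \<Omega>" "\<And>X. X \<in> \<D> \<Longrightarrow> \<exists>a b. X = cbox a b" "\<Union>\<D> = \<Omega>"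
    using open_countable_Union_open_cbox[OF \<Omega>] by metis
  have "negligible (\<Union>X\<in>\<D>. {x \<in> X. f x \<noteq> 0})"
  proof (rule negligible_countable_Union)
    show "countable ((\<lambda>X. {x \<in> X. f x \<noteq> 0}) ` \<D>)" using \<D>(1) by simp
    fix Y assume "Y \<in> (\<lambda>X. {x \<in> X. f x \<noteq> 0}) ` \<D>"
    then obtain X where X: "X \<in> \<D>" "Y = {x \<in> X. f x \<noteq> 0}" by blast
    then obtain a b where "X = cbox a b" using \<D>(3) by blast
    moreover have "X \<subseteq> \<Omega>" using X(1) \<D>(2) by blast
    ultimately show "negligible Y" using local[of a b] X(2) by simp
  qed
  then have "negligible {x \<in> \<Omega>. f x \<noteq> 0}"
    by (rule negligible_subset) (use \<D>(4) in auto)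
  then have "AE x in lebesgue. x \<notin> {x \<in> \<Omega>. f x \<noteq> 0}"
    using AE_not_in negligible_iff_null_sets by blast
  then show ?thesis
    using open_in_lebesgue[OF \<Omega>] by (simp add: AE_restrict_space_iff)
qed

text \<open>The functional is defined through one arbitrarily chosen weak gradient. By uniqueness, bounds on a
classical gradient transfer to that choice.\<close>
lemma weak_gradient_unique:
  fixes u :: "'a::euclidean_space \<Rightarrow> real"
  assumes \<Omega>: "open \<Omega>" and G: "has_weak_gradient \<Omega> u G" and G': "has_weak_gradient \<Omega> u G'"
  shows "AE x in lebesgue_on \<Omega>. G x = G' x"
proof -
  have "AE x in lebesgue_on \<Omega>. G x \<bullet> i - G' x \<bullet> i = 0" if i: "i \<in> Basis" for i
  proof (rule fundamental_lemma[OF \<Omega>])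
    have p: "has_weak_partial \<Omega> i u (\<lambda>x. G x \<bullet> i)" "has_weak_partial \<Omega> i u (\<lambda>x. G' x \<bullet> i)"
      using G G' i by (auto simp: has_weak_gradient_def)
    show "locally_integrable \<Omega> (\<lambda>x. G x \<bullet> i - G' x \<bullet> i)"
      using p by (simp add: has_weak_partial_def locally_integrable_def)
    fix \<phi> assume \<phi>: "\<phi> \<in> test_functions \<Omega>"
    have "integrable (lebesgue_on \<Omega>) (\<lambda>x. v x * \<phi> x)" if "locally_integrable \<Omega> v" for v
    proof (rule locally_integrable_mult_integrable[OF that, where K="closure {x. \<phi> x \<noteq> 0}"])
      have "C_diff 0 \<phi>" using \<phi> unfolding test_functions_def by blast
      then show "continuous_on UNIV \<phi>" by simp
    qed (use \<phi> closure_subset[of "{x. \<phi> x \<noteq> 0}"] open_in_lebesgue[OF \<Omega>] in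
          \<open>auto simp: test_functions_def\<close>)
    then show "(LINT x|lebesgue_on \<Omega>. (G x \<bullet> i - G' x \<bullet> i) * \<phi> x) = 0"
      using p \<phi> by (simp add: has_weak_partial_def left_diff_distrib)
  qed
  then have "AE x in lebesgue_on \<Omega>. \<forall>i\<in>Basis. G x \<bullet> i - G' x \<bullet> i = 0"
    by (simp add: eventually_ball_finite_distrib)
  then show ?thesis by eventually_elim (simp add: euclidean_eq_iff[of "G _"])
qed

section \<open>The convex set of admissible functions\<close>
lemma Linf_norm_AE_le: "Linf_norm \<Omega> f \<le> ereal c \<Longrightarrow> AE x in lebesgue_on \<Omega>. norm (f x) \<le> c"
  unfolding Linf_norm_def using esssup_AE[where M="lebesgue_on \<Omega>" and f="\<lambda>x. ereal (norm (f x))"]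
  by (auto elim!: eventually_mono) (metis ereal_less_eq(3) order_trans)

lemma Linf_norm_leI:
  assumes "(\<lambda>x. norm (f x)) \<in> borel_measurable (lebesgue_on \<Omega>)" "AE x in lebesgue_on \<Omega>. norm (f x) \<le> c"
  shows "Linf_norm \<Omega> f \<le> ereal c"
  unfolding Linf_norm_def using assms by (intro esssup_I) auto

lemma sobolev_has_weak_gradient:
  assumes "u \<in> sobolev (Suc k) p \<Omega>"
  shows "has_weak_gradient \<Omega> u (weak_gradient \<Omega> u)"
proof -
  have "\<forall>i\<in>Basis. \<exists>v. has_weak_partial \<Omega> i u v" using assms by auto
  then obtain v where v: "\<And>i. i \<in> Basis \<Longrightarrow> has_weak_partial \<Omega> i u (v i)" by metis
  have "has_weak_gradient \<Omega> u (\<lambda>x. \<Sum>i\<in>Basis. v i x *\<^sub>R i)"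
    unfolding has_weak_gradient_def using v by (auto simp: inner_sum_left_Basis)
  then show ?thesis unfolding weak_gradient_def by (rule someI[where P="has_weak_gradient \<Omega> u"])
qed

lemma K_zero_lipschitz_on_ball:
  assumes "open \<Omega>" "bounded \<Omega>" "u \<in> K_zero \<Omega>" "ball c r \<subseteq> \<Omega>" "x \<in> ball c r" "z \<in> ball c r"
  shows "\<bar>u x - u z\<bar> \<le> norm (x - z)"
proof (rule weak_gradient_imp_lipschitz[OF assms(1,2) _ _ _ _ assms(4-6)])
  show "continuous_on (closure \<Omega>) u" "\<forall>x\<in>frontier \<Omega>. u x = 0"
    using assms(3) by (auto simp: K_zero_def C_closure_def)
  show "has_weak_gradient \<Omega> u (weak_gradient \<Omega> u)"
    using assms(3) by (intro sobolev_has_weak_gradient[of _ 0 \<infinity>]) (auto simp: K_zero_def)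
  have "Linf_norm \<Omega> (weak_gradient \<Omega> u) \<le> ereal 1"
    using assms(3) by (simp add: K_zero_def one_ereal_def)
  then show "AE x in lebesgue_on \<Omega>. norm (weak_gradient \<Omega> u x) \<le> 1" by (rule Linf_norm_AE_le)
qed

lemma frontier_nonempty:
  fixes \<Omega> :: "'a::euclidean_space set"
  assumes "bounded \<Omega>" "\<Omega> \<noteq> {}"
  shows "frontier \<Omega> \<noteq> {}"
  using assms not_bounded_UNIV[where 'a='a] by (auto simp: frontier_eq_empty)

text \<open>A ball is connected; if it met both \<open>\<Omega>\<close> and its complement, it would contain a frontier point
closer to \<open>x\<close> than the distance allows.\<close>
lemma ball_infdist_frontier_subset:
  fixes \<Omega> :: "'a::euclidean_space set"
  assumes "x \<in> \<Omega>"
  shows "ball x (infdist x (frontier \<Omega>)) \<subseteq> \<Omega>"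
proof (rule ccontr)
  assume *: "\<not> ball x (infdist x (frontier \<Omega>)) \<subseteq> \<Omega>"
  then have "x \<in> ball x (infdist x (frontier \<Omega>))"
    by (metis centre_in_ball ball_eq_empty empty_subsetI not_le)
  then have "ball x (infdist x (frontier \<Omega>)) \<inter> \<Omega> \<noteq> {}" "ball x (infdist x (frontier \<Omega>)) - \<Omega> \<noteq> {}"
    using assms * by blast+
  then obtain y where y: "y \<in> ball x (infdist x (frontier \<Omega>))" "y \<in> frontier \<Omega>"
    using connected_Int_frontier[OF connected_ball] by blast
  then show False using infdist_le[of y "frontier \<Omega>" x] by simp
qed

lemma infdist_compl_eq_frontier:
  fixes \<Omega> :: "'a::euclidean_space set"
  assumes "open \<Omega>" "bounded \<Omega>" "x \<in> \<Omega>"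
  shows "infdist x (- \<Omega>) = infdist x (frontier \<Omega>)"
proof (rule antisym)
  have ne: "frontier \<Omega> \<noteq> {}" using frontier_nonempty assms by blast
  have sub: "frontier \<Omega> \<subseteq> - \<Omega>" using assms(1) by (auto simp: frontier_def interior_open)
  show "infdist x (- \<Omega>) \<le> infdist x (frontier \<Omega>)" by (rule infdist_mono[OF sub ne])
  have cl: "closed (- \<Omega>)" "- \<Omega> \<noteq> {}" using assms(1) ne sub by auto
  obtain y where y: "y \<in> - \<Omega>" "infdist x (- \<Omega>) = dist x y"
    using infdist_attains_inf[OF cl] by blast
  then have "y \<notin> ball x (infdist x (frontier \<Omega>))" using ball_infdist_frontier_subset[OF assms(3)] by auto
  then show "infdist x (frontier \<Omega>) \<le> infdist x (- \<Omega>)" using y(2) by simp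
qed

text \<open>Walk from \<open>x\<close> to a nearest boundary point \<open>y\<close>. The half-open segment lies in the largest ball around \<open>x\<close>
inside \<open>\<Omega>\<close>, where \<open>u\<close> is 1-Lipschitz, and \<open>u\<close> tends to zero at \<open>y\<close>.\<close>
lemma K_zero_le_distance:
  fixes \<Omega> :: "'a::euclidean_space set"
  assumes "open \<Omega>" "bounded \<Omega>" "u \<in> K_zero \<Omega>" and x: "x \<in> \<Omega>"
  shows "\<bar>u x\<bar> \<le> infdist x (frontier \<Omega>)"
proof -
  let ?r = "infdist x (frontier \<Omega>)"
  have ne: "frontier \<Omega> \<noteq> {}" using frontier_nonempty assms by blast
  obtain y where y: "y \<in> frontier \<Omega>" "?r = dist x y"
    using infdist_attains_inf[OF frontier_closed ne] by blast
  have "y \<notin> \<Omega>" using y(1) assms(1) by (auto simp: frontier_def interior_open)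
  then have r: "?r > 0" using y(2) x by auto
  define t where "t n = 1 - inverse (real (Suc n))" for n
  have t: "0 \<le> t n" "t n < 1" for n by (auto simp: t_def field_simps)
  define p where "p n = x + t n *\<^sub>R (y - x)" for n
  have norm_p: "norm (x - p n) \<le> ?r" and p: "p n \<in> ball x ?r" for n
  proof -
    have e: "norm (x - p n) = t n * ?r" using t(1)[of n] y(2) by (simp add: p_def dist_norm norm_minus_commute)
    then show "norm (x - p n) \<le> ?r" using t[of n] r by (simp add: mult_left_le_one_le)
    have "t n * ?r < 1 * ?r" using t(2)[of n] r by (intro mult_strict_right_mono) auto
    then show "p n \<in> ball x ?r" using e by (simp add: dist_norm)
  qed
  note sub = ball_infdist_frontier_subset[OF x]
  have "\<bar>u x - u (p n)\<bar> \<le> ?r" for n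
    using K_zero_lipschitz_on_ball[OF assms(1-3) sub _ p, of x n] r norm_p[of n] by simp
  moreover have "(\<lambda>n. \<bar>u x - u (p n)\<bar>) \<longlonglongrightarrow> \<bar>u x - u y\<bar>"
  proof -
    have "t \<longlonglongrightarrow> 1 - 0" unfolding t_def by (intro tendsto_intros LIMSEQ_inverse_real_of_nat)
    then have "p \<longlonglongrightarrow> x + 1 *\<^sub>R (y - x)" unfolding p_def by (intro tendsto_intros) simp
    then have "p \<longlonglongrightarrow> y" by simp
    moreover have "continuous_on (closure \<Omega>) u" using assms(3) by (simp add: K_zero_def C_closure_def)
    moreover have "y \<in> closure \<Omega>" using y(1) by (simp add: frontier_def)
    moreover have "p n \<in> closure \<Omega>" for n using p[of n] sub closure_subset by blast
    ultimately have "(\<lambda>n. u (p n)) \<longlonglongrightarrow> u y"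
      using continuous_on_tendsto_compose[of "closure \<Omega>" u p y sequentially] by simp
    then show ?thesis by (intro tendsto_intros)
  qed
  ultimately have "\<bar>u x - u y\<bar> \<le> ?r" by (intro LIMSEQ_le_const2) auto
  moreover have "u y = 0" using assms(3) y(1) by (simp add: K_zero_def)
  ultimately show ?thesis by simp
qed

lemma mollify_measurable:
  assumes "continuous_on UNIV f" "continuous_on UNIV k"
  shows "mollify k f \<in> borel_measurable borel"
proof -
  have "(\<lambda>(x, y). f y * k (x - y)) \<in> borel_measurable (borel \<Otimes>\<^sub>M borel)"
    unfolding borel_prod split_beta
    by (intro borel_measurable_continuous_onI continuous_intros continuous_on_compose2[OF assms(1)]
          continuous_on_compose2[OF assms(2)]) auto
  then have "(\<lambda>(x, y). f y * k (x - y)) \<in> borel_measurable (borel \<Otimes>\<^sub>M lborel)"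
    by (simp cong: measurable_cong_sets)
  then show ?thesis unfolding mollify_def by (rule lborel.borel_measurable_lebesgue_integral)
qed

section \<open>Approximation of the distance function by admissible functions\<close>
lemma test_function_bounds:
  assumes \<phi>: "\<phi> \<in> test_functions \<Omega>"
  obtains B where "continuous_on UNIV \<phi>" "\<And>x. \<bar>\<phi> x\<bar> \<le> B" "bounded {x. \<phi> x \<noteq> 0}" "\<And>x. x \<notin> \<Omega> \<Longrightarrow> \<phi> x = 0"
proof -
  have "C_diff 0 \<phi>" using \<phi> unfolding test_functions_def by blast
  then have c: "continuous_on UNIV \<phi>" by simp
  have K: "compact (closure {x. \<phi> x \<noteq> 0})" "closure {x. \<phi> x \<noteq> 0} \<subseteq> \<Omega>"
    using \<phi> by (auto simp: test_functions_def)
  have "bounded (\<phi> ` closure {x. \<phi> x \<noteq> 0})"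
    by (intro compact_imp_bounded compact_continuous_image continuous_on_subset[OF c] K(1)) simp
  then obtain B where B: "\<And>x. x \<in> closure {x. \<phi> x \<noteq> 0} \<Longrightarrow> \<bar>\<phi> x\<bar> \<le> B" by (auto simp: bounded_iff)
  have "\<bar>\<phi> x\<bar> \<le> \<bar>B\<bar>" for x
  proof (cases "\<phi> x = 0")
    case False
    then have "x \<in> closure {x. \<phi> x \<noteq> 0}" using closure_subset[of "{x. \<phi> x \<noteq> 0}"] by auto
    then show ?thesis using B[of x] by linarith
  qed simp
  moreover have "bounded {x. \<phi> x \<noteq> 0}"
    using K(1) closure_subset bounded_subset compact_imp_bounded by metis
  moreover have "\<phi> x = 0" if "x \<notin> \<Omega>" for x
    using K(2) closure_subset[of "{x. \<phi> x \<noteq> 0}"] that by auto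
  ultimately show thesis using that c by metis
qed

lemma test_function_derivative:
  assumes \<phi>: "\<phi> \<in> test_functions \<Omega>" and i: "i \<in> Basis"
  shows "((\<lambda>t. \<phi> (x + t *\<^sub>R i)) has_real_derivative frechet_derivative \<phi> (at (x + t *\<^sub>R i)) i) (at t)"
    and "(\<lambda>x. frechet_derivative \<phi> (at x) i) \<in> test_functions \<Omega>"
proof -
  have C: "C_diff k \<phi>" for k using \<phi> unfolding test_functions_def by blast
  have "C_diff (Suc 0) \<phi>" by (rule C)
  then have D: "(\<phi> has_derivative frechet_derivative \<phi> (at x)) (at x)" for x
    using frechet_derivative_works by auto
  have "((\<lambda>t. x + t *\<^sub>R i) has_derivative (\<lambda>t. t *\<^sub>R i)) (at t)"
    by (auto intro!: derivative_eq_intros)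
  from has_derivative_compose[OF this D]
  have "((\<lambda>t. \<phi> (x + t *\<^sub>R i)) has_derivative (\<lambda>s. frechet_derivative \<phi> (at (x + t *\<^sub>R i)) (s *\<^sub>R i))) (at t)" .
  moreover have "frechet_derivative \<phi> (at (x + t *\<^sub>R i)) (s *\<^sub>R i) = frechet_derivative \<phi> (at (x + t *\<^sub>R i)) i * s" for s
    using linear_cmul[OF has_derivative_linear[OF D]] by simp
  ultimately show "((\<lambda>t. \<phi> (x + t *\<^sub>R i)) has_real_derivative frechet_derivative \<phi> (at (x + t *\<^sub>R i)) i) (at t)"
    by (simp add: has_field_derivative_def)
  have K: "compact (closure {x. \<phi> x \<noteq> 0})" "closure {x. \<phi> x \<noteq> 0} \<subseteq> \<Omega>"
    using \<phi> by (auto simp: test_functions_def)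
  have zero: "frechet_derivative \<phi> (at x) i = 0" if x: "x \<notin> closure {x. \<phi> x \<noteq> 0}" for x
  proof -
    have "(\<phi> has_derivative (\<lambda>_. 0)) (at x)"
    proof (rule has_derivative_transform_within_open[of "\<lambda>_. 0" _ _ _ "- closure {x. \<phi> x \<noteq> 0}"])
      show "\<And>x. x \<in> - closure {x. \<phi> x \<noteq> 0} \<Longrightarrow> 0 = \<phi> x"
        using closure_subset[of "{x. \<phi> x \<noteq> 0}"] by auto
    qed (use x in auto)
    then have "(\<lambda>_. 0) = frechet_derivative \<phi> (at x)" by (rule frechet_derivative_at)
    then show ?thesis by metis
  qed
  have sub: "closure {x. frechet_derivative \<phi> (at x) i \<noteq> 0} \<subseteq> closure {x. \<phi> x \<noteq> 0}"
    by (rule closure_minimal) (use zero in auto)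
  then have "compact (closure {x. frechet_derivative \<phi> (at x) i \<noteq> 0})"
    using K(1) by (meson bounded_subset closed_closure compact_eq_bounded_closed)
  moreover have "C_diff k (\<lambda>x. frechet_derivative \<phi> (at x) i)" for k
    using C[of "Suc k"] i by simp
  ultimately show "(\<lambda>x. frechet_derivative \<phi> (at x) i) \<in> test_functions \<Omega>"
    using sub K(2) by (auto simp: test_functions_def)
qed

text \<open>Integration by parts: the product of \<open>w\<close> with a test function has compact support and a bounded
directional derivative, whose integral therefore vanishes.\<close>
lemma classical_derivative_is_weak_partial:
  fixes w :: "'a::euclidean_space \<Rightarrow> real"
  assumes w: "continuous_on UNIV w" "\<And>x. \<bar>w x\<bar> \<le> B" "\<And>x. x \<notin> \<Omega> \<Longrightarrow> w x = 0"
    and der: "\<And>x t. ((\<lambda>t. w (x + t *\<^sub>R i)) has_real_derivative g (x + t *\<^sub>R i)) (at t)"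
    and g: "g \<in> borel_measurable borel" "\<And>x. \<bar>g x\<bar> \<le> C"
    and \<Omega>: "\<Omega> \<in> sets lebesgue" and i: "i \<in> Basis"
  shows "has_weak_partial \<Omega> i w g"
  unfolding has_weak_partial_def
proof (intro conjI ballI)
  have wm: "w \<in> borel_measurable borel" using w(1) by (rule borel_measurable_continuous_onI)
  show "locally_integrable \<Omega> w" by (rule locally_integrable_bounded[OF wm w(2)])
  show "locally_integrable \<Omega> g" by (rule locally_integrable_bounded[OF g])
  fix \<phi> assume \<phi>: "\<phi> \<in> test_functions \<Omega>"
  let ?d = "\<lambda>x. frechet_derivative \<phi> (at x) i"
  obtain P where P: "continuous_on UNIV \<phi>" "\<And>x. \<bar>\<phi> x\<bar> \<le> P" "bounded {x. \<phi> x \<noteq> 0}" "\<And>x. x \<notin> \<Omega> \<Longrightarrow> \<phi> x = 0"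
    using test_function_bounds[OF \<phi>] by blast
  obtain Q where Q: "continuous_on UNIV ?d" "\<And>x. \<bar>?d x\<bar> \<le> Q" "bounded {x. ?d x \<noteq> 0}" "\<And>x. x \<notin> \<Omega> \<Longrightarrow> ?d x = 0"
    using test_function_bounds[OF test_function_derivative(2)[OF \<phi> i]] by blast
  have pm: "\<phi> \<in> borel_measurable borel" using P(1) by (rule borel_measurable_continuous_onI)
  have dm: "?d \<in> borel_measurable borel" using Q(1) by (rule borel_measurable_continuous_onI)
  let ?\<psi>' = "\<lambda>x. g x * \<phi> x + w x * ?d x"
  have der': "((\<lambda>t. w (x + t *\<^sub>R i) * \<phi> (x + t *\<^sub>R i)) has_real_derivative ?\<psi>' (x + t *\<^sub>R i)) (at t)" for x t
    using DERIV_mult[OF der[of x t] test_function_derivative(1)[OF \<phi> i, of x t]] by (simp add: mult.commute)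
  have bd: "\<bar>?\<psi>' x\<bar> \<le> C * P + B * Q" for x
  proof -
    have "\<bar>?\<psi>' x\<bar> \<le> \<bar>g x\<bar> * \<bar>\<phi> x\<bar> + \<bar>w x\<bar> * \<bar>?d x\<bar>"
      by (rule order_trans[OF abs_triangle_ineq]) (simp add: abs_mult)
    also have "\<dots> \<le> C * P + B * Q"
      using g(2)[of x] P(2)[of x] w(2)[of x] Q(2)[of x]
      by (intro add_mono mult_mono) (auto intro: order_trans[OF abs_ge_zero])
    finally show ?thesis .
  qed
  have c\<psi>: "continuous_on UNIV (\<lambda>x. w x * \<phi> x)" by (intro continuous_intros w P)
  have I: "integrable lborel ?\<psi>'" "integral\<^sup>L lborel ?\<psi>' = 0"
    using integral_directional_derivative_eq_0[OF c\<psi> P(3) _ der' bd] by auto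
  have I2: "integrable lborel (\<lambda>x. w x * ?d x)"
    by (rule bounded_support_integrable[OF _ Q(3)]) (auto intro!: continuous_intros w Q)
  have I1: "integrable lborel (\<lambda>x. g x * \<phi> x)"
    using Bochner_Integration.integrable_diff[OF I(1) I2] by simp
  have "(LINT x|lebesgue_on \<Omega>. w x * ?d x) = (\<integral>x. w x * ?d x \<partial>lborel)"
    by (rule integral_lebesgue_on_eq_lborel[OF \<Omega>]) (use w(3) wm dm in auto)
  moreover have "(LINT x|lebesgue_on \<Omega>. g x * \<phi> x) = (\<integral>x. g x * \<phi> x \<partial>lborel)"
    by (rule integral_lebesgue_on_eq_lborel[OF \<Omega>]) (use P(4) g(1) pm in auto)
  moreover have "(\<integral>x. g x * \<phi> x \<partial>lborel) + (\<integral>x. w x * ?d x \<partial>lborel) = 0"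
    using I(2) I1 I2 by simp
  ultimately show "(LINT x|lebesgue_on \<Omega>. w x * ?d x) = - (LINT x|lebesgue_on \<Omega>. g x * \<phi> x)"
    by linarith
qed

lemma lipschitz_derivative_bound:
  fixes f :: "real \<Rightarrow> real"
  assumes "(f has_real_derivative D) (at 0)" "\<And>t. \<bar>f t - f 0\<bar> \<le> L * \<bar>t\<bar>"
  shows "\<bar>D\<bar> \<le> L"
proof -
  have "((\<lambda>h. \<bar>(f h - f 0) / h\<bar>) \<longlongrightarrow> \<bar>D\<bar>) (at 0)"
    using assms(1) by (intro tendsto_intros) (simp add: DERIV_def)
  moreover have "eventually (\<lambda>h. \<bar>(f h - f 0) / h\<bar> \<le> L) (at 0)"
    using assms(2) by (auto simp: eventually_at divide_le_eq intro!: exI[of _ 1])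
  ultimately show ?thesis by (intro tendsto_upperbound[of _ _ "at (0::real)"]) auto
qed

lemma borel_measurable_lebesgue_on_AE:
  fixes f g :: "'a::euclidean_space \<Rightarrow> 'b::euclidean_space"
  assumes f: "f \<in> borel_measurable (lebesgue_on S)" and ae: "AE x in lebesgue_on S. f x = g x"
    and S: "S \<in> sets lebesgue"
  shows "g \<in> borel_measurable (lebesgue_on S)"
proof -
  have "AE x in lebesgue. (if x \<in> S then f x else 0) = (if x \<in> S then g x else 0)"
    using ae S by (simp add: AE_restrict_space_iff)
  from borel_measurable_AE[OF borel_measurable_if_I[OF f S] this] show ?thesis
    by (rule borel_measurable_if_D)
qed

text \<open>Membership speaks about the chosen weak gradient, whose measurability is part of a finite essential
supremum; both its measurability and its bound come from almost everywhere equality with the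
classical gradient \<open>G\<close>.\<close>
lemma K_zeroI_classical:
  fixes w :: "'a::euclidean_space \<Rightarrow> real" and G :: "'a \<Rightarrow> 'a"
  assumes \<Omega>: "open \<Omega>" and w: "continuous_on UNIV w" "\<And>x. \<bar>w x\<bar> \<le> B" "\<And>x. x \<notin> \<Omega> \<Longrightarrow> w x = 0"
    and der: "\<And>x t e. ((\<lambda>t. w (x + t *\<^sub>R e)) has_real_derivative G (x + t *\<^sub>R e) \<bullet> e) (at t)"
    and G: "\<And>i. i \<in> Basis \<Longrightarrow> (\<lambda>x. G x \<bullet> i) \<in> borel_measurable borel" "\<And>x. norm (G x) \<le> 1"
  shows "w \<in> K_zero \<Omega>"
proof -
  have \<Omega>l: "\<Omega> \<in> sets lebesgue" by (rule open_in_lebesgue[OF \<Omega>])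
  have Gi: "\<bar>G x \<bullet> i\<bar> \<le> 1" if "i \<in> Basis" for x i
    using Basis_le_norm[OF that, of "G x"] G(2)[of x] by linarith
  have wp: "has_weak_partial \<Omega> i w (\<lambda>x. G x \<bullet> i)" if "i \<in> Basis" for i
    by (rule classical_derivative_is_weak_partial[OF w der G(1) Gi \<Omega>l]) (use that in auto)
  have L: "f \<in> L_space \<infinity> \<Omega>" if "f \<in> borel_measurable borel" "\<And>x. \<bar>f x\<bar> \<le> C" for f and C :: real
  proof -
    have m: "f \<in> borel_measurable (lebesgue_on \<Omega>)"
      using that(1) by (simp add: measurable_completion measurable_restrict_space1)
    have "Linf_norm \<Omega> f \<le> ereal C"
      by (rule Linf_norm_leI) (use m that(2) in auto)
    then show ?thesis using m by (auto simp: L_space_def intro: le_less_trans)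
  qed
  have wm: "w \<in> borel_measurable borel" using w(1) by (rule borel_measurable_continuous_onI)
  have "\<exists>v\<in>L_space \<infinity> \<Omega>. has_weak_partial \<Omega> i w v" if i: "i \<in> Basis" for i
    using wp[OF i] L[OF G(1)[OF i] Gi[OF i]] by blast
  then have sob: "w \<in> sobolev (Suc 0) \<infinity> \<Omega>"
    using L[OF wm w(2)] by simp
  have hG: "has_weak_gradient \<Omega> w G" using wp by (simp add: has_weak_gradient_def)
  have ae: "AE x in lebesgue_on \<Omega>. G x = weak_gradient \<Omega> w x"
    by (rule weak_gradient_unique[OF \<Omega> hG sobolev_has_weak_gradient[OF sob]])
  have Gm: "G \<in> borel_measurable borel" using G(1) by (simp add: borel_measurable_euclidean_space[of G])
  have "G \<in> borel_measurable (lebesgue_on \<Omega>)"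
    using Gm by (simp add: measurable_completion measurable_restrict_space1)
  then have "weak_gradient \<Omega> w \<in> borel_measurable (lebesgue_on \<Omega>)"
    by (rule borel_measurable_lebesgue_on_AE[OF _ ae \<Omega>l])
  then have "Linf_norm \<Omega> (weak_gradient \<Omega> w) \<le> ereal 1"
    using ae G(2) by (intro Linf_norm_leI) (auto elim!: eventually_mono, metis)
  moreover have "frontier \<Omega> \<inter> \<Omega> = {}" using \<Omega> by (auto simp: frontier_def interior_open)
  ultimately show ?thesis
    using sob w(3) continuous_on_subset[OF w(1), of "closure \<Omega>"]
    by (auto simp: K_zero_def C_closure_def one_ereal_def)
qed


lemma mollify_lipschitz:
  assumes "continuous_on UNIV f" and Lip: "\<And>x y. \<bar>f x - f y\<bar> \<le> norm (x - y)" and "mollifier \<epsilon> \<rho>"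
  shows "\<bar>mollify \<rho> f x - mollify \<rho> f z\<bar> \<le> norm (x - z)"
proof (rule mollify_diff_bound[OF assms(1,1,3)])
  show "\<bar>f (x - y) - f (z - y)\<bar> \<le> norm (x - z)" for y
    using Lip[of "x - y" "z - y"] by simp
qed

text \<open>A mollified 1-Lipschitz function is 1-Lipschitz, so each directional derivative \<open>G x \<bullet> e\<close> is bounded by
\<open>norm e\<close>. The choice \<open>e = G x\<close> bounds the full gradient by one, not merely its components.\<close>
lemma mollify_gradient:
  fixes f :: "'a::euclidean_space \<Rightarrow> real"
  assumes f: "continuous_on UNIV f" "bounded S" "\<And>x. x \<notin> S \<Longrightarrow> f x = 0"
    and Lip: "\<And>x y. \<bar>f x - f y\<bar> \<le> norm (x - y)" and \<rho>: "mollifier \<epsilon> \<rho>"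
  obtains G :: "'a \<Rightarrow> 'a" where
    "\<And>x t e. ((\<lambda>t. mollify \<rho> f (x + t *\<^sub>R e)) has_real_derivative G (x + t *\<^sub>R e) \<bullet> e) (at t)"
    "\<And>i. i \<in> Basis \<Longrightarrow> (\<lambda>x. G x \<bullet> i) \<in> borel_measurable borel" "\<And>x. norm (G x) \<le> 1"
proof -
  have fr: "flat_algebra \<rho>" using \<rho> by (simp add: mollifier_def)
  define D where "D e = mollify (\<lambda>z. frechet_derivative \<rho> (at z) e) f" for e
  have cD: "continuous_on S (\<lambda>z. frechet_derivative \<rho> (at z) e)" for e S
    by (rule flat_algebra_continuous[OF flat_algebra_derivative(2)[OF fr]])
  have int: "integrable lborel (\<lambda>y. f y * frechet_derivative \<rho> (at (x - y)) e)" for x e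
    by (rule bounded_support_integrable[OF _ f(2)])
      (use f(3) in \<open>auto intro!: continuous_intros f(1) continuous_on_compose2[OF cD[of UNIV]]\<close>)
  have der: "((\<lambda>t. mollify \<rho> f (x + t *\<^sub>R e)) has_real_derivative D e (x + t *\<^sub>R e)) (at t)" for x t e
    unfolding D_def by (rule mollify_has_derivative[OF f fr])
  define G where "G x = (\<Sum>i\<in>Basis. D i x *\<^sub>R i)" for x
  have Gi: "G x \<bullet> i = D i x" if "i \<in> Basis" for x i
    using that by (simp add: G_def inner_sum_left_Basis)
  have GD: "G x \<bullet> e = D e x" for x e
  proof -
    have "D e x = (\<integral>y. (\<Sum>i\<in>Basis. (e \<bullet> i) * (f y * frechet_derivative \<rho> (at (x - y)) i)) \<partial>lborel)"
      unfolding D_def mollify_def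
      by (subst frechet_derivative_components[OF flat_algebra_derivative(1)[OF fr]])
        (simp only: sum_distrib_left mult_ac)
    also have "\<dots> = (\<Sum>i\<in>Basis. (e \<bullet> i) * D i x)"
      unfolding D_def mollify_def using int by (subst Bochner_Integration.integral_sum) auto
    also have "\<dots> = G x \<bullet> e"
      unfolding euclidean_inner[of "G x" e] by (intro sum.cong refl) (simp add: Gi mult.commute)
    finally show ?thesis by simp
  qed
  have mLip: "\<bar>mollify \<rho> f x - mollify \<rho> f z\<bar> \<le> norm (x - z)" for x z
    by (rule mollify_lipschitz[OF f(1) Lip \<rho>])
  have Db: "\<bar>D e x\<bar> \<le> norm e" for e x
  proof (rule lipschitz_derivative_bound[where f="\<lambda>t. mollify \<rho> f (x + t *\<^sub>R e)"])
    show "((\<lambda>t. mollify \<rho> f (x + t *\<^sub>R e)) has_real_derivative D e x) (at 0)"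
      using der[of x e 0] by simp
    show "\<bar>mollify \<rho> f (x + t *\<^sub>R e) - mollify \<rho> f (x + 0 *\<^sub>R e)\<bar> \<le> norm e * \<bar>t\<bar>" for t
      using mLip[of "x + t *\<^sub>R e" x] by (simp add: mult.commute)
  qed
  show thesis
  proof (rule that[of G])
    show "((\<lambda>t. mollify \<rho> f (x + t *\<^sub>R e)) has_real_derivative G (x + t *\<^sub>R e) \<bullet> e) (at t)" for x t e
      unfolding GD by (rule der)
    show "(\<lambda>x. G x \<bullet> i) \<in> borel_measurable borel" for i
      unfolding GD D_def by (rule mollify_measurable[OF f(1) cD])
    show "norm (G x) \<le> 1" for x
    proof -
      have "(norm (G x))\<^sup>2 \<le> norm (G x)"
        using Db[of "G x" x] GD[of x "G x"] by (simp add: power2_norm_eq_inner)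
      then show ?thesis by (cases "G x = 0") (auto simp: power2_eq_square)
    qed
  qed
qed

text \<open>The distance function itself is only Lipschitz. Cutting it off at height \<open>\<epsilon>\<close> yields a 1-Lipschitz
function that vanishes within distance \<open>\<epsilon>\<close> of the complement; mollifying it with radius \<open>\<epsilon>\<close> then keeps
it zero outside \<open>\<Omega>\<close> and produces a classical gradient of norm at most one. Each of the two steps
changes the values by at most \<open>\<epsilon>\<close>.\<close>
lemma distance_approximation:
  fixes \<Omega> :: "'a::euclidean_space set"
  assumes \<Omega>: "open \<Omega>" "bounded \<Omega>" "\<Omega> \<noteq> {}" and \<epsilon>: "\<epsilon> > 0"
  shows "\<exists>w\<in>K_zero \<Omega>. (\<forall>x. 0 \<le> w x) \<and> (\<forall>x\<in>\<Omega>. \<bar>w x - infdist x (frontier \<Omega>)\<bar> \<le> 2 * \<epsilon>)"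
proof -
  \<comment> \<open>The distance to the complement, unlike the distance to the frontier, is zero off \<open>\<Omega>\<close>.\<close>
  define f where "f x = max 0 (infdist x (- \<Omega>) - \<epsilon>)" for x
  have Lip: "\<bar>f x - f y\<bar> \<le> norm (x - y)" for x y
    using infdist_triangle_abs[of x "- \<Omega>" y] by (auto simp: f_def dist_norm)
  have cf: "continuous_on UNIV f" unfolding f_def by (intro continuous_intros)
  have f0: "f x = 0" if "infdist x (- \<Omega>) \<le> \<epsilon>" for x using that by (simp add: f_def)
  have fS: "f x = 0" if "x \<notin> \<Omega>" for x using that \<epsilon> by (intro f0) simp
  have fnn: "0 \<le> f x" for x by (simp add: f_def)
  obtain \<rho> :: "'a \<Rightarrow> real" where \<rho>: "mollifier \<epsilon> \<rho>" using mollifier_exists[OF \<epsilon>] by blast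
  let ?w = "mollify \<rho> f"
  obtain G :: "'a \<Rightarrow> 'a" where G:
    "\<And>x t e. ((\<lambda>t. ?w (x + t *\<^sub>R e)) has_real_derivative G (x + t *\<^sub>R e) \<bullet> e) (at t)"
    "\<And>i. i \<in> Basis \<Longrightarrow> (\<lambda>x. G x \<bullet> i) \<in> borel_measurable borel" "\<And>x. norm (G x) \<le> 1"
    using mollify_gradient[OF cf \<Omega>(2) fS Lip \<rho>] by blast
  have wLip: "\<bar>?w x - ?w z\<bar> \<le> norm (x - z)" for x z
    by (rule mollify_lipschitz[OF cf Lip \<rho>])
  have w0: "?w x = 0" if "x \<notin> \<Omega>" for x
  proof -
    have "\<bar>?w x - mollify \<rho> (\<lambda>_. 0) x\<bar> \<le> 0"
    proof (rule mollify_diff_bound[OF cf _ \<rho>])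
      fix y :: 'a assume "norm y < \<epsilon>"
      moreover have "infdist (x - y) (- \<Omega>) \<le> dist (x - y) x" using that by (intro infdist_le) simp
      ultimately show "\<bar>f (x - y) - 0\<bar> \<le> 0" using f0[of "x - y"] by (simp add: dist_norm)
    qed simp
    then show ?thesis by (simp add: mollify_const[OF \<rho>])
  qed
  have wf: "\<bar>?w x - f x\<bar> \<le> \<epsilon>" for x
  proof -
    have "\<bar>?w x - mollify \<rho> (\<lambda>_. f x) x\<bar> \<le> \<epsilon>"
    proof (rule mollify_diff_bound[OF cf _ \<rho>])
      fix y :: 'a assume "norm y < \<epsilon>"
      then show "\<bar>f (x - y) - f x\<bar> \<le> \<epsilon>" using Lip[of "x - y" x] by simp
    qed simp
    then show ?thesis by (simp add: mollify_const[OF \<rho>])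
  qed
  have wc: "continuous_on UNIV ?w"
  proof (rule continuous_onI)
    fix z :: 'a and e :: real assume "e > 0"
    moreover have "dist (?w x) (?w z) \<le> e" if "dist x z < e" for x
      using wLip[of x z] that by (simp add: dist_norm)
    ultimately show "\<exists>d>0. \<forall>x\<in>UNIV. dist x z < d \<longrightarrow> dist (?w x) (?w z) \<le> e" by blast
  qed
  obtain B where B: "\<And>x. x \<in> \<Omega> \<Longrightarrow> \<bar>?w x\<bar> \<le> B"
  proof -
    have "bounded (?w ` closure \<Omega>)"
      using \<Omega>(2) by (intro compact_imp_bounded compact_continuous_image continuous_on_subset[OF wc]) auto
    then show thesis using that closure_subset[of \<Omega>] by (auto simp: bounded_iff)
  qed
  have "\<bar>?w x\<bar> \<le> \<bar>B\<bar>" for x using B[of x] w0[of x] by (cases "x \<in> \<Omega>") auto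
  then have "?w \<in> K_zero \<Omega>" using K_zeroI_classical[OF \<Omega>(1) wc _ w0 G] by blast
  moreover have "0 \<le> ?w x" for x
    unfolding mollify_def using fnn \<rho> by (intro integral_nonneg_AE always_eventually) (simp add: mollifier_def)
  moreover have "\<bar>?w x - infdist x (frontier \<Omega>)\<bar> \<le> 2 * \<epsilon>" if "x \<in> \<Omega>" for x
  proof -
    have "\<bar>f x - infdist x (frontier \<Omega>)\<bar> \<le> \<epsilon>"
      unfolding f_def infdist_compl_eq_frontier[OF \<Omega>(1,2) that]
      using infdist_nonneg[of x "frontier \<Omega>"] \<epsilon> by (auto simp: max_def)
    then show ?thesis using wf[of x] by linarith
  qed
  ultimately show ?thesis by (intro bexI[of _ ?w]) auto
qed

section \<open>Superposition with Caratheodory functions\<close>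

text \<open>Rounding \<open>g\<close> to multiples of \<open>1 / (n + 1)\<close> makes it countably valued, so only the measurability of
\<open>f\<close> at fixed second arguments is used; continuity in the second argument gives the limit.\<close>
lemma caratheodory_compose_measurable:
  fixes f :: "'b \<Rightarrow> real \<Rightarrow> real"
  assumes m: "\<And>s. (\<lambda>x. f x s) \<in> borel_measurable M" and c: "\<And>x. x \<in> space M \<Longrightarrow> continuous_on UNIV (f x)"
    and g[measurable]: "g \<in> borel_measurable M"
  shows "(\<lambda>x. f x (g x)) \<in> borel_measurable M"
proof (rule borel_measurable_LIMSEQ_real)
  define r where "r n x = real_of_int \<lfloor>real (Suc n) * g x\<rfloor> / real (Suc n)" for n x
  show "(\<lambda>x. f x (r n x)) \<in> borel_measurable M" for n
    unfolding r_def
    by (rule measurable_compose_countable[where f="\<lambda>k x. f x (real_of_int k / real (Suc n))"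
          and g="\<lambda>x. \<lfloor>real (Suc n) * g x\<rfloor>"]) (use m in auto)
  fix x assume x: "x \<in> space M"
  have "\<bar>r n x - g x\<bar> \<le> inverse (real (Suc n))" for n
  proof -
    have "\<bar>real (Suc n) * r n x - real (Suc n) * g x\<bar> \<le> 1"
      unfolding r_def by simp linarith
    then have "real (Suc n) * \<bar>r n x - g x\<bar> \<le> 1"
      by (simp add: abs_mult flip: right_diff_distrib)
    then show ?thesis by (simp add: field_simps)
  qed
  then have "(\<lambda>n. r n x - g x) \<longlonglongrightarrow> 0"
    by (intro Lim_null_comparison[OF _ LIMSEQ_inverse_real_of_nat] always_eventually) simp
  then have "(\<lambda>n. r n x) \<longlonglongrightarrow> g x" by (simp add: LIM_zero_iff)
  then show "(\<lambda>n. f x (r n x)) \<longlonglongrightarrow> f x (g x)"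
    by (intro continuous_on_tendsto_compose[OF c[OF x]]) auto
qed

lemma H_prim_eq_set_integral: "0 \<le> s \<Longrightarrow> H_prim h x s = (\<integral>\<tau>. indicator {0..s} \<tau> * h x \<tau> \<partial>lborel)"
  unfolding H_prim_def zero_ereal_def
  by (subst interval_integral_Icc) (simp_all add: set_lebesgue_integral_def)

text \<open>Applied on the product space with \<open>g = snd\<close>, the preceding lemma gives joint measurability of \<open>h\<close>;
measurability of the parameter-dependent integral is then Fubini's theorem.\<close>
lemma H_prim_compose_measurable:
  fixes h :: "'b \<Rightarrow> real \<Rightarrow> real"
  assumes m: "\<And>s. (\<lambda>x. h x s) \<in> borel_measurable M" and c: "\<And>x. x \<in> space M \<Longrightarrow> continuous_on UNIV (h x)"
    and g[measurable]: "g \<in> borel_measurable M" and g0: "\<And>x. x \<in> space M \<Longrightarrow> 0 \<le> g x"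
  shows "(\<lambda>x. H_prim h x (g x)) \<in> borel_measurable M"
proof -
  have [measurable]: "(\<lambda>p. h (fst p) (snd p)) \<in> borel_measurable (M \<Otimes>\<^sub>M lborel)"
  proof (rule caratheodory_compose_measurable[where f="\<lambda>p. h (fst p)" and g=snd])
    show "(\<lambda>p. h (fst p) s) \<in> borel_measurable (M \<Otimes>\<^sub>M lborel)" for s
      by (rule measurable_compose[OF measurable_fst m])
  qed (use c in \<open>auto simp: space_pair_measure\<close>)
  have "(\<lambda>(x, \<tau>). if 0 \<le> \<tau> \<and> \<tau> \<le> g x then h x \<tau> else 0) \<in> borel_measurable (M \<Otimes>\<^sub>M lborel)"
    unfolding split_beta by measurable
  then have "(\<lambda>x. \<integral>\<tau>. (if 0 \<le> \<tau> \<and> \<tau> \<le> g x then h x \<tau> else 0) \<partial>lborel) \<in> borel_measurable M"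
    by (rule lborel.borel_measurable_lebesgue_integral)
  then show ?thesis
  proof (rule measurable_cong[THEN iffD1, rotated])
    fix x assume "x \<in> space M"
    then show "(\<integral>\<tau>. (if 0 \<le> \<tau> \<and> \<tau> \<le> g x then h x \<tau> else 0) \<partial>lborel) = H_prim h x (g x)"
      by (subst H_prim_eq_set_integral)
        (auto simp: g0 indicator_def intro!: Bochner_Integration.integral_cong)
  qed
qed

lemma H_prim_mean_value:
  assumes c: "continuous_on UNIV (h x)" and st: "0 \<le> s" "s < t"
  obtains z where "s < z" "z < t" "H_prim h x t - H_prim h x s = h x z * (t - s)"
proof -
  have H: "H_prim h x r = integral {0..r} (h x)" if "0 \<le> r" for r
    unfolding H_prim_def zero_ereal_def using that
    by (intro interval_integral_eq_integral borel_integrable_atLeastAtMost' continuous_on_subset[OF c]) auto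
  have der: "((\<lambda>r. integral {0..r} (h x)) has_derivative (\<lambda>d. h x r * d)) (at r within {s..t})"
    if r: "r \<in> {s..t}" for r
  proof -
    have "((\<lambda>r. integral {0..r} (h x)) has_real_derivative h x r) (at r within {0..t})"
      by (rule integral_has_real_derivative) (use r st in \<open>auto intro: continuous_on_subset[OF c]\<close>)
    then have "((\<lambda>r. integral {0..r} (h x)) has_real_derivative h x r) (at r within {s..t})"
      by (rule DERIV_subset) (use st in auto)
    then show ?thesis by (simp add: has_field_derivative_def)
  qed
  have "\<exists>z\<in>{s<..<t}. integral {0..t} (h x) - integral {0..s} (h x) = h x z * (t - s)"
    by (rule mvt_simple[OF st(2)]) (use der in auto)
  then obtain z where "z \<in> {s<..<t}" "integral {0..t} (h x) - integral {0..s} (h x) = h x z * (t - s)"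
    by blast
  then show thesis using that H st by auto
qed

lemma abs_integral_le_const:
  fixes f :: "'b \<Rightarrow> real"
  assumes "finite_measure M" "AE x in M. \<bar>f x\<bar> \<le> c" "0 \<le> c"
  shows "\<bar>integral\<^sup>L M f\<bar> \<le> c * measure M (space M)"
proof (cases "integrable M f")
  case True
  interpret finite_measure M by fact
  have "\<bar>integral\<^sup>L M f\<bar> \<le> (\<integral>x. \<bar>f x\<bar> \<partial>M)" by (rule integral_abs_bound)
  also have "\<dots> \<le> (\<integral>x. c \<partial>M)" by (rule integral_mono_AE) (use True assms in auto)
  finally show ?thesis by (simp add: mult.commute)
next
  case False
  then show ?thesis using assms(3) by (simp add: not_integrable_integral_eq)
qed

section \<open>Energy gap below the distance function\<close>

text \<open>All admissible functions take values in \<open>[-D, D]\<close>, so a single constant \<open>A\<close> bounds the nonlinearity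
on the relevant range. Positivity is stated for positive arguments because the competitors are
nonnegative.\<close>
locale positive_nonlinearity =
  fixes \<Omega> :: "'a::euclidean_space set" and h :: "'a \<Rightarrow> real \<Rightarrow> real" and A D :: real
  assumes dom: "open \<Omega>" "bounded \<Omega>" "\<Omega> \<noteq> {}"
    and hm: "\<And>s. (\<lambda>x. h x s) \<in> borel_measurable (lebesgue_on \<Omega>)"
    and hc: "AE x in lebesgue_on \<Omega>. continuous_on UNIV (h x)"
    and hpos: "AE x in lebesgue_on \<Omega>. \<forall>s>0. h x s > 0"
    and hA: "AE x in lebesgue_on \<Omega>. \<forall>s. \<bar>s\<bar> \<le> D \<longrightarrow> \<bar>h x s\<bar> \<le> A"
    and A_nonneg: "0 \<le> A"
    and D: "\<And>x. x \<in> \<Omega> \<Longrightarrow> infdist x (frontier \<Omega>) \<le> D"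
begin

abbreviation dst :: "'a \<Rightarrow> real" where "dst x \<equiv> infdist x (frontier \<Omega>)"

definition potential :: "('a \<Rightarrow> real) \<Rightarrow> real" where
  "potential v = (LINT x|lebesgue_on \<Omega>. H_prim h x (v x))"

lemma domain_lebesgue: "\<Omega> \<in> sets lebesgue" by (rule open_in_lebesgue[OF dom(1)])

lemma space_domain: "space (lebesgue_on \<Omega>) = \<Omega>" by (simp add: space_restrict_space)

lemma finite_domain: "finite_measure (lebesgue_on \<Omega>)"
  using dom by (intro finite_measure_lebesgue_on bounded_set_imp_lmeasurable domain_lebesgue)

lemma D_nonneg: "0 \<le> D"
  using dom(3) D infdist_nonneg by (metis ex_in_conv order_trans)

text \<open>By the mean value theorem an increment of the primitive is \<open>h x z * (t - s)\<close> with \<open>z > 0\<close>.\<close>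
lemma H_prim_increasing:
  "AE x in lebesgue_on \<Omega>. \<forall>s t. 0 \<le> s \<longrightarrow> s \<le> t \<longrightarrow> t \<le> D \<longrightarrow>
     0 \<le> H_prim h x t - H_prim h x s \<and> H_prim h x t - H_prim h x s \<le> A * (t - s) \<and>
     (s < t \<longrightarrow> 0 < H_prim h x t - H_prim h x s)"
  using hc hpos hA
proof eventually_elim
  case (elim x)
  have "0 < H_prim h x t - H_prim h x s \<and> H_prim h x t - H_prim h x s \<le> A * (t - s)"
    if st: "0 \<le> s" "s < t" "t \<le> D" for s t
  proof -
    obtain z where z: "s < z" "z < t" "H_prim h x t - H_prim h x s = h x z * (t - s)"
      using H_prim_mean_value[where h=h and x=x, OF elim(1) st(1,2)] by blast
    have "0 < h x z" using elim(2) z st by simp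
    moreover have "h x z \<le> A" using elim(3)[rule_format, of z] z st by simp
    ultimately show ?thesis using z(3) st(2) by simp
  qed
  then show ?case by (metis diff_self less_eq_real_def mult_zero_right)
qed

lemma H_prim_0: "H_prim h x 0 = 0"
  by (simp add: H_prim_def interval_integral_endpoints_same zero_ereal_def)

text \<open>Setting \<open>h\<close> to zero on the null set of points where it fails to be continuous gives a genuine
Caratheodory function without affecting the integral.\<close>
lemma H_prim_integrable:
  assumes v: "v \<in> borel_measurable (lebesgue_on \<Omega>)" and vb: "\<And>x. x \<in> \<Omega> \<Longrightarrow> 0 \<le> v x \<and> v x \<le> D"
  shows "integrable (lebesgue_on \<Omega>) (\<lambda>x. H_prim h x (v x))"
proof -
  obtain N where N: "N \<in> null_sets (lebesgue_on \<Omega>)" "{x \<in> space (lebesgue_on \<Omega>). \<not> continuous_on UNIV (h x)} \<subseteq> N"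
    using hc by (auto elim!: AE_E simp: null_sets_def)
  define h' where "h' x s = (if x \<in> N then 0 else h x s)" for x s
  have Ns: "N \<in> sets (lebesgue_on \<Omega>)" using N(1) by auto
  have "(\<lambda>x. H_prim h' x (v x)) \<in> borel_measurable (lebesgue_on \<Omega>)"
  proof (rule H_prim_compose_measurable[OF _ _ v])
    show "(\<lambda>x. h' x s) \<in> borel_measurable (lebesgue_on \<Omega>)" for s
      unfolding h'_def using Ns by (intro measurable_If_set hm) auto
    show "continuous_on UNIV (h' x)" if "x \<in> space (lebesgue_on \<Omega>)" for x
      using N(2) that by (cases "x \<in> N") (auto simp: h'_def[abs_def])
  qed (use vb space_domain in auto)
  moreover have "AE x in lebesgue_on \<Omega>. H_prim h' x (v x) = H_prim h x (v x)"
    using AE_not_in[OF N(1)] by eventually_elim (simp add: H_prim_def h'_def)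
  ultimately have m: "(\<lambda>x. H_prim h x (v x)) \<in> borel_measurable (lebesgue_on \<Omega>)"
    by (rule borel_measurable_lebesgue_on_AE[OF _ _ domain_lebesgue])
  interpret finite_measure "lebesgue_on \<Omega>" by (rule finite_domain)
  have "AE x in lebesgue_on \<Omega>. norm (H_prim h x (v x)) \<le> A * D"
    using H_prim_increasing AE_space
  proof eventually_elim
    case (elim x)
    then have vx: "0 \<le> v x" "v x \<le> D" using vb space_domain by auto
    have "0 \<le> H_prim h x (v x)" "H_prim h x (v x) \<le> A * v x"
      using elim(1)[rule_format, of 0 "v x"] vx by (simp_all add: H_prim_0)
    moreover have "A * v x \<le> A * D" using vx A_nonneg by (intro mult_left_mono)
    ultimately show ?case by simp
  qed
  then show ?thesis using m by (rule integrable_const_bound)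
qed

lemma continuous_measurable: "continuous_on \<Omega> v \<Longrightarrow> v \<in> borel_measurable (lebesgue_on \<Omega>)"
  by (rule continuous_imp_measurable_on_sets_lebesgue[OF _ domain_lebesgue])

lemma dst_continuous: "continuous_on S dst" by (intro continuous_intros)

lemma dst_integrable: "integrable (lebesgue_on \<Omega>) (\<lambda>x. H_prim h x (dst x))"
  using D by (intro H_prim_integrable continuous_measurable dst_continuous) (auto simp: infdist_nonneg)

lemma K_zero_bounds:
  assumes "v \<in> K_zero \<Omega>" "x \<in> \<Omega>"
  shows "v x \<le> dst x" "\<bar>v x\<bar> \<le> D"
  using K_zero_le_distance[OF dom(1,2) assms] D[OF assms(2)] by auto

lemma K_zero_measurable:
  assumes "v \<in> K_zero \<Omega>" shows "v \<in> borel_measurable (lebesgue_on \<Omega>)"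
  using assms closure_subset[of \<Omega>]
  by (intro continuous_measurable) (auto simp: K_zero_def C_closure_def intro: continuous_on_subset)

lemma K_zero_integrable:
  assumes "v \<in> K_zero \<Omega>" "\<And>x. x \<in> \<Omega> \<Longrightarrow> 0 \<le> v x"
  shows "integrable (lebesgue_on \<Omega>) (\<lambda>x. H_prim h x (v x))"
  using assms K_zero_bounds by (intro H_prim_integrable K_zero_measurable) (auto simp: abs_le_iff)

text \<open>Outside \<open>K_zero \<Omega>\<close> the functional is infinite, whereas some competitor has finite energy.\<close>
lemma minimizer_in_K_zero:
  assumes min: "I_fun \<Omega> h lam \<mu> u = (INF v\<in>C_closure \<Omega>. I_fun \<Omega> h lam \<mu> v)"
  shows "u \<in> K_zero \<Omega>"
proof (rule ccontr)
  assume u: "u \<notin> K_zero \<Omega>"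
  obtain w where w: "w \<in> K_zero \<Omega>" 
    using distance_approximation[OF dom zero_less_one] by auto
  then have "I_fun \<Omega> h lam \<mu> u \<le> I_fun \<Omega> h lam \<mu> w"
    unfolding min by (intro INF_lower) (simp add: K_zero_def)
  then show False using u w by (simp add: I_fun_def Psi_def)
qed

abbreviation vol :: real where "vol \<equiv> measure (lebesgue_on \<Omega>) \<Omega>"

text \<open>In the comparison of the energies of \<open>u\<close> and \<open>w\<close>, the gradient term and the quadratic term are bounded
on \<open>K_zero \<Omega>\<close> by constants independent of \<open>\<mu>\<close>. Only the potential is multiplied by \<open>\<mu>\<close>.\<close>
lemma minimizer_potential_gap_K_zero:
  assumes min: "I_fun \<Omega> h lam \<mu> u = (INF v\<in>C_closure \<Omega>. I_fun \<Omega> h lam \<mu> v)"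
    and w: "w \<in> K_zero \<Omega>"
  shows "\<mu> * (potential w - potential u) \<le> (2 + \<bar>lam\<bar> * D\<^sup>2) * vol"
proof -
  have u: "u \<in> K_zero \<Omega>" by (rule minimizer_in_K_zero[OF min])
  define P where "P v = (LINT x|lebesgue_on \<Omega>. 1 - sqrt (1 - (norm (weak_gradient \<Omega> v x))\<^sup>2))" for v
  define Q where "Q v = (LINT x|lebesgue_on \<Omega>. (v x)\<^sup>2)" for v :: "'a \<Rightarrow> real"
  have P: "\<bar>P v\<bar> \<le> vol" if "v \<in> K_zero \<Omega>" for v
  proof -
    have "Linf_norm \<Omega> (weak_gradient \<Omega> v) \<le> ereal 1"
      using that by (simp add: K_zero_def one_ereal_def)
    then have "AE x in lebesgue_on \<Omega>. norm (weak_gradient \<Omega> v x) \<le> 1" by (rule Linf_norm_AE_le)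
    then have "AE x in lebesgue_on \<Omega>. \<bar>1 - sqrt (1 - (norm (weak_gradient \<Omega> v x))\<^sup>2)\<bar> \<le> 1"
    proof eventually_elim
      case (elim x)
      then have "(norm (weak_gradient \<Omega> v x))\<^sup>2 \<le> 1" by (simp add: power_le_one)
      then have "0 \<le> sqrt (1 - (norm (weak_gradient \<Omega> v x))\<^sup>2)" "sqrt (1 - (norm (weak_gradient \<Omega> v x))\<^sup>2) \<le> 1"
        by (auto simp: real_sqrt_le_1_iff)
      then show ?case by linarith
    qed
    from abs_integral_le_const[OF finite_domain this] show ?thesis by (simp add: P_def space_domain)
  qed
  have Q: "\<bar>Q v\<bar> \<le> D\<^sup>2 * vol" if "v \<in> K_zero \<Omega>" for v
  proof -
    have "AE x in lebesgue_on \<Omega>. \<bar>(v x)\<^sup>2\<bar> \<le> D\<^sup>2"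
      using AE_space
    proof eventually_elim
      case (elim x)
      then show ?case using K_zero_bounds(2)[OF that, of x] D_nonneg space_domain
        by (simp add: abs_le_square_iff[symmetric])
    qed
    from abs_integral_le_const[OF finite_domain this] show ?thesis by (simp add: Q_def space_domain)
  qed
  have I: "I_fun \<Omega> h lam \<mu> v = ereal (P v - lam / 2 * Q v - \<mu> * potential v)" if "v \<in> K_zero \<Omega>" for v
    using that by (simp add: I_fun_def Psi_def P_def Q_def potential_def)
  have "I_fun \<Omega> h lam \<mu> u \<le> I_fun \<Omega> h lam \<mu> w"
    unfolding min using w by (intro INF_lower) (simp add: K_zero_def)
  then have "\<mu> * (potential w - potential u) \<le> P w - P u + (lam / 2 * Q u - lam / 2 * Q w)"
    by (simp add: I u w algebra_simps)
  also have "\<dots> \<le> 2 * vol + \<bar>lam\<bar> * (D\<^sup>2 * vol)"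
  proof -
    have *: "\<bar>lam / 2 * Q v\<bar> \<le> \<bar>lam\<bar> / 2 * (D\<^sup>2 * vol)" if "v \<in> K_zero \<Omega>" for v
      using Q[OF that] by (simp add: abs_mult mult_left_mono)
    show ?thesis using P[OF u] P[OF w] *[OF u] *[OF w] by linarith
  qed
  finally show ?thesis by (simp add: algebra_simps)
qed

lemma potential_dst_approximation:
  assumes "\<eta> > 0"
  obtains w where "w \<in> K_zero \<Omega>" "potential dst - potential w \<le> \<eta>"
proof -
  define q where "q = A * vol + 1"
  define \<epsilon> where "\<epsilon> = \<eta> / (2 * q)"
  have p: "q > 0" using A_nonneg by (simp add: q_def add_nonneg_pos)
  then have \<epsilon>: "\<epsilon> > 0" using assms by (simp add: \<epsilon>_def)
  obtain w where w: "w \<in> K_zero \<Omega>" "\<And>x. 0 \<le> w x" "\<And>x. x \<in> \<Omega> \<Longrightarrow> \<bar>w x - dst x\<bar> \<le> 2 * \<epsilon>"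
    using distance_approximation[OF dom \<epsilon>] by auto
  have "AE x in lebesgue_on \<Omega>. \<bar>H_prim h x (dst x) - H_prim h x (w x)\<bar> \<le> A * (2 * \<epsilon>)"
    using H_prim_increasing AE_space
  proof eventually_elim
    case (elim x)
    then have x: "x \<in> \<Omega>" using space_domain by simp
    have "\<bar>H_prim h x (dst x) - H_prim h x (w x)\<bar> \<le> A * (dst x - w x)"
      using elim(1)[rule_format, of "w x" "dst x"] w(2) K_zero_bounds(1)[OF w(1) x] D[OF x] by simp
    also have "\<dots> \<le> A * (2 * \<epsilon>)" using w(3)[OF x] A_nonneg by (intro mult_left_mono) auto
    finally show ?case .
  qed
  from abs_integral_le_const[OF finite_domain this]
  have "potential dst - potential w \<le> A * (2 * \<epsilon>) * vol"
    using dst_integrable K_zero_integrable[OF w(1,2)] A_nonneg \<open>\<epsilon> > 0\<close> by (simp add: potential_def space_domain)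
  also have "\<dots> \<le> q * (2 * \<epsilon>)" using \<open>\<epsilon> > 0\<close> by (simp add: q_def algebra_simps)
  also have "\<dots> = \<eta>" using p by (simp add: \<epsilon>_def)
  finally show thesis using that w(1) by blast
qed

text \<open>The constant does not depend on the competitor, so the competitor may tend to the distance function.\<close>
lemma minimizer_potential_gap:
  assumes min: "I_fun \<Omega> h lam \<mu> u = (INF v\<in>C_closure \<Omega>. I_fun \<Omega> h lam \<mu> v)" and \<mu>: "\<mu> > 0"
  shows "\<mu> * (potential dst - potential u) \<le> (2 + \<bar>lam\<bar> * D\<^sup>2) * vol"
proof (rule field_le_epsilon)
  fix e :: real assume "e > 0"
  then obtain w where w: "w \<in> K_zero \<Omega>" "potential dst - potential w \<le> e / \<mu>"
    using potential_dst_approximation[of "e / \<mu>"] \<mu> by auto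
  have "\<mu> * (potential dst - potential w) \<le> e" using w(2) \<mu> by (simp add: field_simps)
  then show "\<mu> * (potential dst - potential u) \<le> (2 + \<bar>lam\<bar> * D\<^sup>2) * vol + e"
    using minimizer_potential_gap_K_zero[OF min w(1)] by (simp add: algebra_simps)
qed

text \<open>The potential drops strictly when the distance function is lowered by \<open>\<delta>\<close> on a ball, because the
primitive is strictly increasing at almost every point and a ball has positive measure.\<close>
lemma local_gap_positive:
  assumes c: "ball c r \<subseteq> \<Omega>" and r: "r > 0" and \<delta>: "\<delta> > 0" "\<And>x. x \<in> ball c r \<Longrightarrow> \<delta> \<le> dst x"
  defines "g \<equiv> \<lambda>x. H_prim h x (dst x) - H_prim h x (if x \<in> ball c r then dst x - \<delta> else dst x)"
  shows "integrable (lebesgue_on \<Omega>) g" "0 < (LINT x|lebesgue_on \<Omega>. g x)"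
proof -
  let ?v = "\<lambda>x. if x \<in> ball c r then dst x - \<delta> else dst x"
  have vb: "0 \<le> ?v x \<and> ?v x \<le> D" if "x \<in> \<Omega>" for x
    using D[OF that] \<delta> infdist_nonneg[of x "frontier \<Omega>"] by (auto simp: less_imp_le intro: order_trans[of _ "dst x"])
  have "?v \<in> borel_measurable borel"
    by (intro measurable_If_set borel_measurable_continuous_onI continuous_intros) auto
  then have "?v \<in> borel_measurable (lebesgue_on \<Omega>)"
    by (simp add: measurable_completion measurable_restrict_space1)
  from dst_integrable H_prim_integrable[OF this vb] show I: "integrable (lebesgue_on \<Omega>) g"
    unfolding g_def by (intro Bochner_Integration.integrable_diff)
  have pos: "AE x in lebesgue_on \<Omega>. 0 \<le> g x \<and> (x \<in> ball c r \<longrightarrow> 0 < g x)"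
    using H_prim_increasing AE_space
  proof eventually_elim
    case (elim x)
    then have x: "x \<in> \<Omega>" using space_domain by simp
    show ?case using elim(1)[rule_format, of "dst x - \<delta>" "dst x"] \<delta> D[OF x] by (auto simp: g_def)
  qed
  then have nn: "AE x in lebesgue_on \<Omega>. 0 \<le> g x" by (auto elim: eventually_mono)
  have "(LINT x|lebesgue_on \<Omega>. g x) \<noteq> 0"
  proof
    assume "(LINT x|lebesgue_on \<Omega>. g x) = 0"
    then have "AE x in lebesgue_on \<Omega>. g x = 0" using integral_nonneg_eq_0_iff_AE[OF I nn] by simp
    with pos have "AE x in lebesgue_on \<Omega>. x \<notin> ball c r" by eventually_elim auto
    then have "AE x in lebesgue. x \<in> \<Omega> \<longrightarrow> x \<notin> ball c r" using domain_lebesgue by (simp add: AE_restrict_space_iff)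
    then have "AE x in lebesgue. x \<in> - ball c r" by eventually_elim (use c in auto)
    then have "c \<in> - ball c r" by (rule mem_closed_if_AE_lebesgue[rotated]) auto
    then show False using r by simp
  qed
  moreover have "0 \<le> (LINT x|lebesgue_on \<Omega>. g x)" using nn by (rule integral_nonneg_AE)
  ultimately show "0 < (LINT x|lebesgue_on \<Omega>. g x)" by simp
qed

text \<open>If \<open>v\<close> lies \<open>2 \<delta>\<close> below the distance at \<open>x\<close>, then by the Lipschitz bounds it lies at least \<open>\<delta>\<close> below
on all points within \<open>\<delta> / 2\<close> of \<open>x\<close>. To make the resulting loss of potential independent of \<open>x\<close>, the
compact set of possible points \<open>x\<close> is covered by finitely many balls of radius \<open>\<delta> / 4\<close>: one of
them contains \<open>x\<close> and lies within \<open>\<delta> / 2\<close> of it, and the least of the finitely many losses is still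
positive.\<close>
lemma potential_gap_if_below_distance:
  assumes \<delta>: "\<delta> > 0"
  obtains m where "m > 0" "\<And>v x. v \<in> K_zero \<Omega> \<Longrightarrow> (\<And>y. y \<in> \<Omega> \<Longrightarrow> 0 \<le> v y) \<Longrightarrow> x \<in> \<Omega> \<Longrightarrow> v x \<le> dst x - 2 * \<delta>
     \<Longrightarrow> m \<le> potential dst - potential v"
proof -
  let ?r = "\<delta> / 4"
  define K where "K = {x \<in> closure \<Omega>. 2 * \<delta> \<le> dst x}"
  have "compact K"
  proof -
    have "closed K" unfolding K_def by (intro closed_Collect_conj closed_Collect_le continuous_intros) auto
    moreover have "bounded K" using dom(2) unfolding K_def by (auto intro: bounded_subset[OF bounded_closure])
    ultimately show ?thesis by (simp add: compact_eq_bounded_closed)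
  qed
  then obtain T where T: "T \<subseteq> K" "finite T" "K \<subseteq> (\<Union>c\<in>T. ball c ?r)"
    using compactE_image[of K K "\<lambda>c. ball c ?r"] \<delta> by (metis (no_types, lifting) UN_I centre_in_ball divide_pos_pos open_ball subsetI zero_less_numeral)
  have KO: "x \<in> \<Omega>" if "x \<in> K" for x
  proof (rule ccontr)
    assume "x \<notin> \<Omega>"
    then have "x \<in> frontier \<Omega>" using that dom(1) by (auto simp: K_def frontier_def interior_open)
    then show False using that \<delta> by (simp add: K_def)
  qed
  have far: "ball c ?r \<subseteq> \<Omega>" "\<And>x. x \<in> ball c ?r \<Longrightarrow> \<delta> \<le> dst x" if "c \<in> K" for c
  proof -
    have "?r \<le> dst c" using that \<delta> by (simp add: K_def)
    then show "ball c ?r \<subseteq> \<Omega>" using ball_infdist_frontier_subset[OF KO[OF that]] subset_ball by blast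
    show "\<delta> \<le> dst x" if "x \<in> ball c ?r" for x
      using infdist_triangle[of c "frontier \<Omega>" x] that \<open>c \<in> K\<close> \<delta> by (simp add: K_def)
  qed
  define g where "g c x = H_prim h x (dst x) - H_prim h x (if x \<in> ball c ?r then dst x - \<delta> else dst x)" for c x
  have g: "integrable (lebesgue_on \<Omega>) (g c)" "0 < (LINT x|lebesgue_on \<Omega>. g c x)" if "c \<in> K" for c
    using local_gap_positive[OF far(1)[OF that] _ \<delta> far(2)[OF that]] \<delta> unfolding g_def by auto
  \<comment> \<open>Inserting 1 covers the case of an empty cover, when no point is that far from the boundary.\<close>
  define m where "m = Min (insert 1 ((\<lambda>c. LINT x|lebesgue_on \<Omega>. g c x) ` T))"
  have "m > 0" unfolding m_def using T g(2) by (subst Min_gr_iff) auto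
  moreover have "m \<le> potential dst - potential v"
    if v: "v \<in> K_zero \<Omega>" "\<And>y. y \<in> \<Omega> \<Longrightarrow> 0 \<le> v y" and x: "x \<in> \<Omega>" "v x \<le> dst x - 2 * \<delta>" for v x
  proof -
    have dx: "2 * \<delta> \<le> dst x" using v(2)[OF x(1)] x(2) by simp
    then have "x \<in> K" using x(1) closure_subset by (auto simp: K_def)
    then obtain c where c: "c \<in> T" "x \<in> ball c ?r" using T(3) by blast
    have cK: "c \<in> K" using c T by blast
    have below: "v y \<le> dst y - \<delta>" if y: "y \<in> ball c ?r" for y
    proof -
      have xy: "dist x y < \<delta> / 2" using dist_triangle[of x y c] c(2) y by (simp add: dist_commute)
      have "\<bar>v x - v y\<bar> \<le> norm (x - y)"
        by (rule K_zero_lipschitz_on_ball[OF dom(1,2) v(1) ball_infdist_frontier_subset[OF x(1)]])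
          (use xy dx \<delta> in auto)
      moreover have "dst x \<le> dst y + dist x y" by (rule infdist_triangle)
      ultimately show ?thesis using xy x(2) by (simp add: dist_norm)
    qed
    have "m \<le> (LINT x|lebesgue_on \<Omega>. g c x)" unfolding m_def using T(2) c(1) by (intro Min_le) auto
    also have "\<dots> \<le> (LINT x|lebesgue_on \<Omega>. H_prim h x (dst x) - H_prim h x (v x))"
    proof (rule integral_mono_AE)
      show "integrable (lebesgue_on \<Omega>) (\<lambda>x. H_prim h x (dst x) - H_prim h x (v x))"
        by (intro Bochner_Integration.integrable_diff dst_integrable K_zero_integrable v)
      show "AE x in lebesgue_on \<Omega>. g c x \<le> H_prim h x (dst x) - H_prim h x (v x)"
        using H_prim_increasing AE_space
      proof eventually_elim
        case (elim y)
        then have y: "y \<in> \<Omega>" using space_domain by simp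
        show ?case
        proof (cases "y \<in> ball c ?r")
          case True
          have "0 \<le> H_prim h y (dst y - \<delta>) - H_prim h y (v y)"
            using elim(1)[rule_format, of "v y" "dst y - \<delta>"] v(2)[OF y] below[OF True] D[OF y] \<delta> by simp
          then show ?thesis using True by (simp add: g_def)
        next
          case False
          have "0 \<le> H_prim h y (dst y) - H_prim h y (v y)"
            using elim(1)[rule_format, of "v y" "dst y"] v(2)[OF y] K_zero_bounds(1)[OF v(1) y] D[OF y] by simp
          then show ?thesis using False by (simp add: g_def)
        qed
      qed
    qed (rule g(1)[OF cK])
    also have "\<dots> = potential dst - potential v"
      using dst_integrable K_zero_integrable[OF v] by (simp add: potential_def)
    finally show ?thesis .
  qed
  ultimately show thesis by (rule that)
qed

end

section \<open>Convergence of the minimizers\<close>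
lemma L_space_infinity_bound:
  assumes "\<alpha> \<in> L_space \<infinity> \<Omega>"
  obtains A where "0 \<le> A" "AE x in lebesgue_on \<Omega>. \<bar>\<alpha> x\<bar> \<le> A"
proof -
  have "Linf_norm \<Omega> \<alpha> < \<infinity>" using assms by (simp add: L_space_def)
  then have "\<exists>r. Linf_norm \<Omega> \<alpha> \<le> ereal r" by (cases "Linf_norm \<Omega> \<alpha>") auto
  then obtain r where "Linf_norm \<Omega> \<alpha> \<le> ereal r" by blast
  then have "Linf_norm \<Omega> \<alpha> \<le> ereal \<bar>r\<bar>" by (rule order_trans) simp
  from Linf_norm_AE_le[OF this] show thesis by (intro that[of "\<bar>r\<bar>"]) auto
qed

theorem corollary2p19:
  fixes \<Omega> :: "'a::euclidean_space set"
    and h :: "'a \<Rightarrow> real \<Rightarrow> real"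
    and lam M :: real
    and u :: "real \<Rightarrow> 'a \<Rightarrow> real"
  assumes dim: "DIM('a) \<ge> 2"
    and domain: "bounded_C2_domain \<Omega>"
    and h1_caratheodory: "caratheodory \<Omega> h"
    and h1_bound: "\<And>\<rho>. \<rho> > 0 \<Longrightarrow> \<exists>\<alpha>\<in>L_space \<infinity> \<Omega>.
          AE x in lebesgue_on \<Omega>. \<forall>s. \<bar>s\<bar> \<le> \<rho> \<longrightarrow> \<bar>h x s\<bar> \<le> \<alpha> x"
    and h2': "AE x in lebesgue_on \<Omega>. \<forall>s. s \<noteq> 0 \<longrightarrow> h x s * s > 0"
    and M: "M > 0"
    and solution: "\<And>\<mu>. \<mu> \<ge> M \<Longrightarrow> is_solution \<Omega> h lam \<mu> (u \<mu>)"
    and minimizer: "\<And>\<mu>. \<mu> \<ge> M \<Longrightarrow> I_fun \<Omega> h lam \<mu> (u \<mu>) = (INF v\<in>C_closure \<Omega>. I_fun \<Omega> h lam \<mu> v)"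
    and nonneg: "\<And>\<mu> x. \<mu> \<ge> M \<Longrightarrow> x \<in> \<Omega> \<Longrightarrow> u \<mu> x \<ge> 0"
  shows "(\<forall>\<mu>s v.
            (\<forall>n. \<mu>s n \<ge> M) \<and> filterlim \<mu>s at_top sequentially \<and>
            uniform_limit (closure \<Omega>) (\<lambda>n. u (\<mu>s n)) v sequentially
            \<longrightarrow> (\<forall>x\<in>closure \<Omega>. v x = infdist x (frontier \<Omega>))) \<and>
         uniform_limit (closure \<Omega>) u (\<lambda>x. infdist x (frontier \<Omega>)) at_top"
proof -
  have dom: "open \<Omega>" "bounded \<Omega>" "\<Omega> \<noteq> {}" using domain by (auto simp: bounded_C2_domain_def)
  let ?d = "\<lambda>x. infdist x (frontier \<Omega>)"
  have "bounded (?d ` closure \<Omega>)"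
    using dom(2) by (intro compact_imp_bounded compact_continuous_image continuous_intros) auto
  then obtain D' where D': "\<And>x. x \<in> closure \<Omega> \<Longrightarrow> \<bar>?d x\<bar> \<le> D'" by (auto simp: bounded_iff)
  define D where "D = \<bar>D'\<bar> + 1"
  have D: "D > 0" "\<And>x. x \<in> \<Omega> \<Longrightarrow> ?d x \<le> D"
  proof -
    show "?d x \<le> D" if "x \<in> \<Omega>" for x
      using D'[of x] closure_subset[of \<Omega>] that unfolding D_def by force
  qed (simp add: D_def)
  obtain \<alpha> where \<alpha>: "\<alpha> \<in> L_space \<infinity> \<Omega>"
      "AE x in lebesgue_on \<Omega>. \<forall>s. \<bar>s\<bar> \<le> D \<longrightarrow> \<bar>h x s\<bar> \<le> \<alpha> x"
    using h1_bound[OF D(1)] by blast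
  obtain A where A: "0 \<le> A" "AE x in lebesgue_on \<Omega>. \<bar>\<alpha> x\<bar> \<le> A"
    using L_space_infinity_bound[OF \<alpha>(1)] by blast
  interpret positive_nonlinearity \<Omega> h A D
  proof
    show "AE x in lebesgue_on \<Omega>. \<forall>s>0. h x s > 0"
      using h2' by eventually_elim (metis less_irrefl zero_less_mult_pos2)
    show "AE x in lebesgue_on \<Omega>. \<forall>s. \<bar>s\<bar> \<le> D \<longrightarrow> \<bar>h x s\<bar> \<le> A"
      using \<alpha>(2) A(2) by eventually_elim (metis abs_ge_self order_trans)
  qed (use dom h1_caratheodory A(1) D(2) in \<open>auto simp: caratheodory_def\<close>)
  define C where "C = (2 + \<bar>lam\<bar> * D\<^sup>2) * vol"
  have lim: "uniform_limit (closure \<Omega>) u ?d at_top"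
  proof (rule uniform_limitI)
    fix e :: real assume e: "e > 0"
    obtain m where m: "m > 0" "\<And>v x. v \<in> K_zero \<Omega> \<Longrightarrow> (\<And>y. y \<in> \<Omega> \<Longrightarrow> 0 \<le> v y) \<Longrightarrow> x \<in> \<Omega> \<Longrightarrow>
        v x \<le> ?d x - 2 * (e / 2) \<Longrightarrow> m \<le> potential ?d - potential v"
      using potential_gap_if_below_distance[of "e / 2"] e by auto
    \<comment> \<open>Past \<open>C / m\<close> the gap forced by minimality is smaller than the gap of any dip of depth \<open>e\<close>.\<close>
    have "eventually (\<lambda>\<mu>. M \<le> \<mu> \<and> C / m < \<mu>) at_top"
      by (intro eventually_conj eventually_ge_at_top eventually_gt_at_top)
    then show "eventually (\<lambda>\<mu>. \<forall>x\<in>closure \<Omega>. dist (u \<mu> x) (?d x) < e) at_top"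
    proof eventually_elim
      case (elim \<mu>)
      have K: "u \<mu> \<in> K_zero \<Omega>" using minimizer elim minimizer_in_K_zero by blast
      have "\<mu> * (potential ?d - potential (u \<mu>)) \<le> C"
        unfolding C_def using minimizer_potential_gap[OF minimizer] elim M by simp
      moreover have "C < \<mu> * m" using elim m(1) by (simp add: field_simps)
      ultimately have "\<mu> * (potential ?d - potential (u \<mu>)) < \<mu> * m" by linarith
      then have gap: "potential ?d - potential (u \<mu>) < m" using elim M by simp
      show ?case
      proof
        fix x assume x: "x \<in> closure \<Omega>"
        show "dist (u \<mu> x) (?d x) < e"
        proof (cases "x \<in> \<Omega>")
          case True
          have "u \<mu> x > ?d x - e" using m(2)[OF K nonneg True] elim gap by (simp add: not_le) (meson not_le)
          moreover have "u \<mu> x \<le> ?d x" by (rule K_zero_bounds(1)[OF K True])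
          ultimately show ?thesis by (simp add: dist_real_def)
        next
          case False
          then have "x \<in> frontier \<Omega>" using x dom(1) by (simp add: frontier_def interior_open)
          then show ?thesis using K e by (simp add: K_zero_def)
        qed
      qed
    qed
  qed
  moreover have "v x = ?d x"
    if \<mu>s: "filterlim \<mu>s at_top sequentially" and v: "uniform_limit (closure \<Omega>) (\<lambda>n. u (\<mu>s n)) v sequentially"
      and x: "x \<in> closure \<Omega>" for \<mu>s v x
  proof (rule LIMSEQ_unique)
    show "(\<lambda>n. u (\<mu>s n) x) \<longlonglongrightarrow> v x" by (rule tendsto_uniform_limitI[OF v x])
    show "(\<lambda>n. u (\<mu>s n) x) \<longlonglongrightarrow> ?d x"
      by (rule filterlim_compose[OF tendsto_uniform_limitI[OF lim x] \<mu>s])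
  qed
  ultimately show ?thesis by blast
qed

end
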